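(* Let $\Gamma=(V,\rho,a,B)$ be an infinite network with $R_{xy}=0$ for all $xy\in E$, and set $$S:=\sup_{xy\in E}\frac{1}{C_{xy}L_{xy}}=\sup_{xy\in E}\frac{D_{xy}}{L_{xy}}.$$ Then $\mathcal{P}(\lambda)=\lim_{n\to\infty}\mathcal{P}_n(\lambda)$ is well-defined (the limit exists in $\mathbb{C}$) and holomorphic in the domain $$\mathbb{C}\setminus\left[-i\sqrt{S},\,i\sqrt{S}\right].$$
   Context: Edge weights. Let $(V,E)$ be a connected undirected graph, edges being unordered pairs $xy$ of vertices; $x\sim y$ means $xy\in E$. Each edge $xy\in E$ carries a resistance $R_{xy}\in[0,+\infty)$, an inductance $L_{xy}\in[0,+\infty)$ and a capacitance $C_{xy}\in(0,+\infty]$; put $D_{xy}=1/C_{xy}\in[0,+\infty)$. It is assumed that $R_{xy}+L_{xy}+D_{xy}>0$. For $\lambda\in\mathbb{C}\setminus\{0\}$ the impedance of the edge is $z_{xy}^{(\lambda)}=R_{xy}+L_{xy}\lambda+\frac{D_{xy}}{\lambda}$ and the admittance is $\rho_{xy}^{(\lambda)}=1/z_{xy}^{(\lambda)}$. Set $\rho_{xy}^{(\lambda)}=0$ if $x\not\sim y$. Convention: $D_{xy}/L_{xy}=1/(C_{xy}L_{xy})=+\infty$ if $L_{xy}=0$ (and $R_{xy}=0$, so that $D_{xy}>0$); if $S=+\infty$, the segment $[-i\sqrt S,i\sqrt S]$ means the whole imaginary axis. Finite networks. Suppose $(V,E)$ is finite, $|V|\ge2$, $a\in V$, $B\subset V$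 is non-empty and $a\notin B$; put $B_0=B\cup\{a\}$. Then $(V,\rho,a,B)$ is called a finite network. Let $\Lambda$ be the set of those $\lambda\in\mathbb{C}\setminus\{0\}$ with $L_{xy}\lambda^2+R_{xy}\lambda+D_{xy}\ne0$ for all $xy\in E$. For $\lambda\in\Lambda$ put $\Delta_\rho f(x)=\sum_{y\in V}(f(y)-f(x))\rho_{xy}^{(\lambda)}$ for $f:V\to\mathbb{C}$, and consider the Dirichlet problem for $v:V\to\mathbb{C}$: $\Delta_\rho v(x)=0$ for $x\in V\setminus B_0$, $v(x)=0$ for $x\in B$, $v(a)=1$. The effective admittance is $\mathcal{P}(\lambda)=\sum_{x\in V}(1-v(x))\rho_{xa}^{(\lambda)}$ where $v$ is any solution (the value does not depend on the choice of the solution); if there is no solution, $\mathcal{P}(\lambda)=\infty$. Infinite networks. Suppose $(V,E)$ is infinite, locally finite and connected, each edge $xy\in E$ carrying a resistance $R_{xy}\in[0,+\infty)$, an inductance $L_{xy}\in[0,+\infty)$ and a capacitance $C_{xy}\in(0,+\infty]$, with $D_{xy}=1/C_{xy}$, $R_{xy}+L_{xy}+D_{xy}>0$, and the admittance $\rho_{xy}^{(\lambda)}=1/\left(R_{xy}+L_{xy}\lambda+\frac{D_{xy}}{\lambda}\right)$ (with $\rho_{xy}^{(\lambda)}=0$ if $x\not\sim y$), $a\in V$, and $B\subset V$ is a (possibly empty) set with $a\notin B$. Then $\Gamma=(V,\rho,a,B)$ is called an infinite network. With $\operatorname{dist}$ the graph distance, for $n\ge1$ put $V_n=\{x\in V:\operatorname{dist}(a,x)\le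 n\}$, let $E_n$ be the set of edges of $E$ with both endpoints in $V_n$, $\rho_n=\rho|_{E_n}$, $\partial V_n=\{x\in V:\operatorname{dist}(a,x)=n\}$, $B_n=(B\cap V_n)\cup\partial V_n$. Then $\mathcal{P}_n(\lambda)$ denotes the effective admittance of the finite network $\Gamma_n=(V_n,\rho_n,a,B_n)$. *)

theory Defs
  imports "HOL-Analysis.Analysis"
begin

section \<open>Graphs\<close>

text \<open>An undirected edge \<open>xy\<close> is the set \<open>{x, y}\<close>; loops are not excluded (a loop
  contributes nothing to the Laplacian).\<close>

definition adjacency :: "'v set set \<Rightarrow> ('v \<times> 'v) set" where
  "adjacency E = {(x, y). {x, y} \<in> E}"

definition graph_dist :: "'v set set \<Rightarrow> 'v \<Rightarrow> 'v \<Rightarrow> nat" where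
  "graph_dist E x y = (LEAST n. (x, y) \<in> adjacency E ^^ n)"


section \<open>Edge weights\<close>

text \<open>Capacitances are extended reals in \<open>(0, \<infinity>]\<close>; since \<open>1 / \<infinity> = 0\<close> in \<^typ>\<open>ereal\<close>, the
  quantity \<open>D = 1 / C\<close> is a genuine nonnegative real on every edge.\<close>

definition inv_capacitance :: "('v set \<Rightarrow> ereal) \<Rightarrow> 'v set \<Rightarrow> real" where
  "inv_capacitance C e = real_of_ereal (1 / C e)"

definition impedance ::
  "('v set \<Rightarrow> real) \<Rightarrow> ('v set \<Rightarrow> real) \<Rightarrow> ('v set \<Rightarrow> ereal) \<Rightarrow> complex \<Rightarrow> 'v set \<Rightarrow> complex" where
  "impedance R L C s e =
     of_real (R e) + of_real (L e) * s + of_real (inv_capacitance C e) / s"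

definition admittance ::
  "'v set set \<Rightarrow> ('v set \<Rightarrow> real) \<Rightarrow> ('v set \<Rightarrow> real) \<Rightarrow> ('v set \<Rightarrow> ereal) \<Rightarrow> complex
    \<Rightarrow> 'v \<Rightarrow> 'v \<Rightarrow> complex" where
  "admittance E R L C s x y = (if {x, y} \<in> E then 1 / impedance R L C s {x, y} else 0)"

text \<open>The frequencies at which all impedances are defined and nonzero. Outside this set
  the admittances, and everything built from them below, are meaningless.\<close>

definition admissible ::
  "'v set set \<Rightarrow> ('v set \<Rightarrow> real) \<Rightarrow> ('v set \<Rightarrow> real) \<Rightarrow> ('v set \<Rightarrow> ereal) \<Rightarrow> complex set" where
  "admissible E R L C =
     {s. s \<noteq> 0 \<and>
       (\<forall>e\<in>E. of_real (L e) * s\<^sup>2 + of_real (R e) * s + of_real (inv_capacitance C e) \<noteq> 0)}"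


section \<open>Networks\<close>

locale weighted_graph =
  fixes V :: "'v set" and E :: "'v set set"
    and R L :: "'v set \<Rightarrow> real" and C :: "'v set \<Rightarrow> ereal"
  assumes edges: "E \<subseteq> {{x, y} | x y. x \<in> V \<and> y \<in> V}"
    and connected: "x \<in> V \<Longrightarrow> y \<in> V \<Longrightarrow> (x, y) \<in> (adjacency E)\<^sup>*"
    and R_nonneg: "e \<in> E \<Longrightarrow> 0 \<le> R e"
    and L_nonneg: "e \<in> E \<Longrightarrow> 0 \<le> L e"
    and C_pos: "e \<in> E \<Longrightarrow> 0 < C e"
    and weight_pos: "e \<in> E \<Longrightarrow> 0 < R e + L e + inv_capacitance C e"

locale finite_network = weighted_graph V E R L C
  for V :: "'v set" and E R L C +
  fixes a :: 'v and B :: "'v set"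
  assumes finite_V: "finite V"
    and card_V: "2 \<le> card V"
    and a_in_V: "a \<in> V"
    and B_subset: "B \<subseteq> V"
    and B_nonempty: "B \<noteq> {}"
    and a_notin_B: "a \<notin> B"

locale infinite_network = weighted_graph V E R L C
  for V :: "'v set" and E R L C +
  fixes a :: 'v and B :: "'v set"
  assumes infinite_V: "infinite V"
    and locally_finite: "x \<in> V \<Longrightarrow> finite {y. {x, y} \<in> E}"
    and a_in_V: "a \<in> V"
    and B_subset: "B \<subseteq> V"
    and a_notin_B: "a \<notin> B"


section \<open>Effective admittance of a finite network\<close>

definition laplacian ::
  "'v set \<Rightarrow> 'v set set \<Rightarrow> ('v set \<Rightarrow> real) \<Rightarrow> ('v set \<Rightarrow> real) \<Rightarrow> ('v set \<Rightarrow> ereal) \<Rightarrow> complex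
    \<Rightarrow> ('v \<Rightarrow> complex) \<Rightarrow> 'v \<Rightarrow> complex" where
  "laplacian V E R L C s f x = (\<Sum>y\<in>V. (f y - f x) * admittance E R L C s x y)"

definition dirichlet_solution ::
  "'v set \<Rightarrow> 'v set set \<Rightarrow> ('v set \<Rightarrow> real) \<Rightarrow> ('v set \<Rightarrow> real) \<Rightarrow> ('v set \<Rightarrow> ereal)
    \<Rightarrow> 'v \<Rightarrow> 'v set \<Rightarrow> complex \<Rightarrow> ('v \<Rightarrow> complex) \<Rightarrow> bool" where
  "dirichlet_solution V E R L C a B s v \<longleftrightarrow>
     (\<forall>x\<in>V - (B \<union> {a}). laplacian V E R L C s v x = 0) \<and> (\<forall>x\<in>B. v x = 0) \<and> v a = 1"

definition input_current ::
  "'v set \<Rightarrow> 'v set set \<Rightarrow> ('v set \<Rightarrow> real) \<Rightarrow> ('v set \<Rightarrow> real) \<Rightarrow> ('v set \<Rightarrow> ereal)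
    \<Rightarrow> 'v \<Rightarrow> complex \<Rightarrow> ('v \<Rightarrow> complex) \<Rightarrow> complex" where
  "input_current V E R L C a s v = (\<Sum>x\<in>V. (1 - v x) * admittance E R L C s x a)"

text \<open>The value \<^term>\<open>None\<close> stands for \<open>\<infinity>\<close>. The choice of the solution is immaterial, see
  \<open>input_current_unique\<close> below.\<close>

definition effective_admittance ::
  "'v set \<Rightarrow> 'v set set \<Rightarrow> ('v set \<Rightarrow> real) \<Rightarrow> ('v set \<Rightarrow> real) \<Rightarrow> ('v set \<Rightarrow> ereal)
    \<Rightarrow> 'v \<Rightarrow> 'v set \<Rightarrow> complex \<Rightarrow> complex option" where
  "effective_admittance V E R L C a B s =
     (if \<exists>v. dirichlet_solution V E R L C a B s v
      then Some (input_current V E R L C a s (SOME v. dirichlet_solution V E R L C a B s v))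
      else None)"

lemma admittance_sym: "admittance E R L C s x y = admittance E R L C s y x"
  by (simp add: admittance_def insert_commute)

lemma laplacian_green:
  "(\<Sum>x\<in>V. g x * laplacian V E R L C s f x) = (\<Sum>x\<in>V. f x * laplacian V E R L C s g x)"
proof -
  let ?p = "admittance E R L C s"
  have "(\<Sum>x\<in>V. g x * laplacian V E R L C s f x) - (\<Sum>x\<in>V. f x * laplacian V E R L C s g x)
      = (\<Sum>x\<in>V. \<Sum>y\<in>V. g x * f y * ?p x y) - (\<Sum>x\<in>V. \<Sum>y\<in>V. f x * g y * ?p x y)"
    unfolding laplacian_def sum_distrib_left sum_subtractf[symmetric]
    by (intro sum.cong refl) (simp add: algebra_simps)
  also have "(\<Sum>x\<in>V. \<Sum>y\<in>V. f x * g y * ?p x y) = (\<Sum>x\<in>V. \<Sum>y\<in>V. g x * f y * ?p x y)"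
    by (subst sum.swap, intro sum.cong refl) (simp add: admittance_sym mult_ac)
  finally show ?thesis by simp
qed

lemma (in finite_network) input_current_unique:
  assumes v: "dirichlet_solution V E R L C a B s v"
    and w: "dirichlet_solution V E R L C a B s w"
  shows "input_current V E R L C a s v = input_current V E R L C a s w"
proof -
  have cur: "input_current V E R L C a s u = - laplacian V E R L C s u a" if "u a = 1" for u
    unfolding input_current_def laplacian_def sum_negf[symmetric] using that
    by (intro sum.cong refl) (simp add: admittance_sym[of E R L C s a] algebra_simps)
  have lap: "(\<Sum>x\<in>V. g x * laplacian V E R L C s f x) = laplacian V E R L C s f a"
    if "dirichlet_solution V E R L C a B s f" "dirichlet_solution V E R L C a B s g" for f g
  proof -
    have "(\<Sum>x\<in>V. g x * laplacian V E R L C s f x)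
        = (\<Sum>x\<in>V. if x = a then laplacian V E R L C s f x else 0)"
      using that by (intro sum.cong refl) (auto simp: dirichlet_solution_def)
    then show ?thesis using finite_V a_in_V by simp
  qed
  have "laplacian V E R L C s v a = laplacian V E R L C s w a"
    using lap[OF v w] lap[OF w v] laplacian_green[of w V E R L C s v] by simp
  then show ?thesis using cur v w by (simp add: dirichlet_solution_def)
qed


section \<open>Exhaustion of an infinite network\<close>

definition trunc_verts :: "'v set \<Rightarrow> 'v set set \<Rightarrow> 'v \<Rightarrow> nat \<Rightarrow> 'v set" where
  "trunc_verts V E a n = {x\<in>V. graph_dist E a x \<le> n}"

definition trunc_edges :: "'v set \<Rightarrow> 'v set set \<Rightarrow> 'v \<Rightarrow> nat \<Rightarrow> 'v set set" where
  "trunc_edges V E a n = {e\<in>E. e \<subseteq> trunc_verts V E a n}"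

definition trunc_boundary :: "'v set \<Rightarrow> 'v set set \<Rightarrow> 'v \<Rightarrow> nat \<Rightarrow> 'v set" where
  "trunc_boundary V E a n = {x\<in>V. graph_dist E a x = n}"

definition trunc_sink :: "'v set \<Rightarrow> 'v set set \<Rightarrow> 'v \<Rightarrow> 'v set \<Rightarrow> nat \<Rightarrow> 'v set" where
  "trunc_sink V E a B n = (B \<inter> trunc_verts V E a n) \<union> trunc_boundary V E a n"

definition trunc_admittance ::
  "'v set \<Rightarrow> 'v set set \<Rightarrow> ('v set \<Rightarrow> real) \<Rightarrow> ('v set \<Rightarrow> real) \<Rightarrow> ('v set \<Rightarrow> ereal)
    \<Rightarrow> 'v \<Rightarrow> 'v set \<Rightarrow> nat \<Rightarrow> complex \<Rightarrow> complex option" where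
  "trunc_admittance V E R L C a B n s =
     effective_admittance (trunc_verts V E a n) (trunc_edges V E a n) R L C a
       (trunc_sink V E a B n) s"

text \<open>Convergence of a sequence in \<open>\<complex> \<union> {\<infinity>}\<close> to a finite limit: the sets \<open>Some ` U\<close>,
  with \<open>U\<close> a neighbourhood of \<open>l\<close> in \<open>\<complex>\<close>, form a neighbourhood base of \<open>l\<close>. In particular
  all but finitely many terms are finite.\<close>

definition tendsto_finite :: "(nat \<Rightarrow> complex option) \<Rightarrow> complex \<Rightarrow> bool" where
  "tendsto_finite p l \<longleftrightarrow> filterlim p (filtermap Some (nhds l)) sequentially"

definition limit_admittance ::
  "'v set \<Rightarrow> 'v set set \<Rightarrow> ('v set \<Rightarrow> real) \<Rightarrow> ('v set \<Rightarrow> real) \<Rightarrow> ('v set \<Rightarrow> ereal)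
    \<Rightarrow> 'v \<Rightarrow> 'v set \<Rightarrow> complex \<Rightarrow> complex" where
  "limit_admittance V E R L C a B s =
     (THE l. tendsto_finite (\<lambda>n. trunc_admittance V E R L C a B n s) l)"

lemma tendsto_finite_iff:
  "tendsto_finite p l \<longleftrightarrow> (\<forall>\<^sub>F n in sequentially. p n \<noteq> None) \<and> (\<lambda>n. the (p n)) \<longlonglongrightarrow> l"
proof
  assume p: "tendsto_finite p l"
  have ev: "\<forall>\<^sub>F n in sequentially. P (p n)" if "\<forall>\<^sub>F z in nhds l. P (Some z)" for P
    using p that unfolding tendsto_finite_def filterlim_iff eventually_filtermap by blast
  show "(\<forall>\<^sub>F n in sequentially. p n \<noteq> None) \<and> (\<lambda>n. the (p n)) \<longlonglongrightarrow> l"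
    using ev[of "\<lambda>q. q \<noteq> None"] ev[of "\<lambda>q. Q (the q)" for Q] by (auto simp: filterlim_iff)
next
  assume p: "(\<forall>\<^sub>F n in sequentially. p n \<noteq> None) \<and> (\<lambda>n. the (p n)) \<longlonglongrightarrow> l"
  show "tendsto_finite p l"
    unfolding tendsto_finite_def filterlim_iff eventually_filtermap
  proof (intro allI impI)
    fix P assume "\<forall>\<^sub>F z in nhds l. P (Some z)"
    with p have "\<forall>\<^sub>F n in sequentially. P (Some (the (p n)))"
      by (auto simp: filterlim_iff)
    with p have "\<forall>\<^sub>F n in sequentially. p n \<noteq> None \<and> P (Some (the (p n)))"
      by (simp add: eventually_conj)
    then show "\<forall>\<^sub>F n in sequentially. P (p n)"
      by (rule eventually_mono) auto
  qed
qed

lemma tendsto_finite_unique: "tendsto_finite p l \<Longrightarrow> tendsto_finite p m \<Longrightarrow> l = m"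
  by (auto simp: tendsto_finite_iff intro: LIMSEQ_unique)

context infinite_network
begin

lemma edge_verts: "{x, y} \<in> E \<Longrightarrow> x \<in> V \<and> y \<in> V"
  using edges by (fastforce simp: doubleton_eq_iff)

lemma dist_walk: "x \<in> V \<Longrightarrow> (a, x) \<in> adjacency E ^^ graph_dist E a x"
  unfolding graph_dist_def using connected[OF a_in_V] rtrancl_imp_relpow
  by (metis (mono_tags, lifting) LeastI_ex)

lemma dist_le: "(a, x) \<in> adjacency E ^^ n \<Longrightarrow> graph_dist E a x \<le> n"
  unfolding graph_dist_def by (rule Least_le)

lemma dist_self: "graph_dist E a a = 0"
  using dist_le[of a 0] by simp

lemma dist_Suc:
  assumes "x \<in> V" "graph_dist E a x = Suc n"
  obtains y where "y \<in> V" "{y, x} \<in> E" "graph_dist E a y = n"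
proof -
  obtain y where y: "(a, y) \<in> adjacency E ^^ n" "{y, x} \<in> E"
    using dist_walk[OF assms(1)] assms(2) by (auto simp: adjacency_def)
  have yV: "y \<in> V" using edge_verts[OF y(2)] by simp
  have "(a, x) \<in> adjacency E ^^ Suc (graph_dist E a y)"
    using dist_walk[OF yV] y(2) by (auto simp: adjacency_def)
  then have "Suc n \<le> Suc (graph_dist E a y)" using dist_le assms(2) by metis
  then show thesis using that y yV dist_le[OF y(1)] by simp
qed

lemma finite_trunc_verts: "finite (trunc_verts V E a n)"
proof -
  have sphere: "finite {x\<in>V. graph_dist E a x = k}" for k
  proof (induction k)
    case 0
    have "{x\<in>V. graph_dist E a x = 0} \<subseteq> {a}" using dist_walk by fastforce
    then show ?case using finite_subset by blast
  next
    case (Suc k)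
    have "{x\<in>V. graph_dist E a x = Suc k}
        \<subseteq> (\<Union>y\<in>{y\<in>V. graph_dist E a y = k}. {x. {y, x} \<in> E})"
      by (auto elim: dist_Suc)
    then show ?case using Suc locally_finite by (auto intro: finite_subset)
  qed
  have "trunc_verts V E a n = (\<Union>k\<le>n. {x\<in>V. graph_dist E a x = k})"
    by (auto simp: trunc_verts_def)
  then show ?thesis using sphere by auto
qed

lemma trunc_boundary_nonempty: "trunc_boundary V E a n \<noteq> {}"
proof -
  obtain x where x: "x \<in> V" "n < graph_dist E a x"
    using finite_trunc_verts[of n] infinite_V
    by (metis (mono_tags, lifting) finite_subset mem_Collect_eq not_le subsetI trunc_verts_def)
  have "\<exists>y\<in>V. graph_dist E a y = n" if "x \<in> V" "graph_dist E a x = n + d" for d x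
    using that by (induction d arbitrary: x) (auto elim: dist_Suc)
  from this[of x "graph_dist E a x - n"] x show ?thesis
    by (auto simp: trunc_boundary_def)
qed

lemma finite_network_trunc:
  assumes n: "1 \<le> n"
  shows "finite_network (trunc_verts V E a n) (trunc_edges V E a n) R L C a (trunc_sink V E a B n)"
proof
  let ?V = "trunc_verts V E a n" and ?E = "trunc_edges V E a n"
  show "?E \<subseteq> {{x, y} | x y. x \<in> ?V \<and> y \<in> ?V}"
  proof
    fix e assume e: "e \<in> ?E"
    then obtain x y where "e = {x, y}" using edges by (auto simp: trunc_edges_def)
    with e show "e \<in> {{x, y} | x y. x \<in> ?V \<and> y \<in> ?V}" by (auto simp: trunc_edges_def)
  qed
  have reach: "(a, x) \<in> (adjacency ?E)\<^sup>*" if "x \<in> V" "graph_dist E a x = k" "k \<le> n" for x k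
    using that
  proof (induction k arbitrary: x)
    case 0
    then show ?case using dist_walk[of x] by simp
  next
    case (Suc k)
    obtain y where y: "y \<in> V" "{y, x} \<in> E" "graph_dist E a y = k"
      using dist_Suc[OF Suc.prems(1,2)] by metis
    have "(y, x) \<in> adjacency ?E"
      using y Suc.prems by (auto simp: adjacency_def trunc_edges_def trunc_verts_def)
    then show ?case using Suc.IH[of y] y Suc.prems by (meson Suc_leD rtrancl.rtrancl_into_rtrancl)
  qed
  have "sym (adjacency ?E)" by (auto simp: sym_def adjacency_def insert_commute)
  then have "sym ((adjacency ?E)\<^sup>*)" by (rule sym_rtrancl)
  then show "(x, y) \<in> (adjacency ?E)\<^sup>*" if "x \<in> ?V" "y \<in> ?V" for x y
    using reach that unfolding trunc_verts_def by (blast dest: symD intro: rtrancl_trans)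
  show aV: "a \<in> ?V" using a_in_V dist_self by (simp add: trunc_verts_def)
  obtain b where b: "b \<in> trunc_boundary V E a n" using trunc_boundary_nonempty by blast
  then have "b \<in> ?V" "b \<noteq> a"
    using n dist_self by (auto simp: trunc_verts_def trunc_boundary_def)
  then have "card {a, b} \<le> card ?V" "card {a, b} = 2"
    using aV card_mono[OF finite_trunc_verts, of "{a, b}" n] by auto
  then show "2 \<le> card ?V" by simp
  show "trunc_sink V E a B n \<noteq> {}" using b by (auto simp: trunc_sink_def)
  show "trunc_sink V E a B n \<subseteq> ?V"
    by (auto simp: trunc_sink_def trunc_verts_def trunc_boundary_def)
  show "a \<notin> trunc_sink V E a B n"
    using n a_notin_B dist_self by (auto simp: trunc_sink_def trunc_boundary_def)
qed (auto simp: trunc_edges_def finite_trunc_verts R_nonneg L_nonneg C_pos weight_pos)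

end


section \<open>The exceptional segment\<close>

text \<open>The quotient \<open>D / L = 1 / (C L)\<close> is \<open>+\<infinity>\<close> by convention when \<open>L = 0\<close>.\<close>

definition sup_ratio :: "'v set set \<Rightarrow> ('v set \<Rightarrow> real) \<Rightarrow> ('v set \<Rightarrow> ereal) \<Rightarrow> ereal" where
  "sup_ratio E L C =
     (SUP e\<in>E. if L e = 0 then \<infinity> else ereal (inv_capacitance C e / L e))"

definition imaginary_segment :: "ereal \<Rightarrow> complex set" where
  "imaginary_segment S =
     (if S = \<infinity> then {z. Re z = 0}
      else closed_segment (- \<i> * of_real (sqrt (real_of_ereal S)))
                          (\<i> * of_real (sqrt (real_of_ereal S))))"

end

theory Submission
  imports Defs "HOL-Complex_Analysis.Complex_Analysis"
begin

text \<open>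
  For \<open>R = 0\<close> the impedance \<open>L s + D / s\<close> of every edge lies in the convex cone spanned by \<open>s\<close>
  and \<open>s + S / s\<close> (by \<open>s\<close> and \<open>1 / s\<close> if \<open>S = \<infinity>\<close>). Off the exceptional segment the two generators
  lie in one open half-plane, so after multiplication by a suitable constant \<open>w\<close> all admittances
  \<open>\<rho>\<close> satisfy \<open>\<kappa> \<bar>\<rho>\<bar> \<le> Re (w \<rho>)\<close>, where \<open>w\<close> and \<open>\<kappa> > 0\<close> depend neither on the edge nor, locally,
  on \<open>s\<close> (\<open>locally_uniformly_sectorial\<close>).

  Under this sector condition the energy form of a finite network is coercive. Coercivity makes
  the Dirichlet problem uniquely solvable (\<open>ex_solution\<close>), and it bounds the effective admittance
  by a multiple of the total absolute admittance at \<open>a\<close> (\<open>effective_admittance_bound\<close>); this bound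
  sees only the neighbours of \<open>a\<close>, hence is the same for all the truncated networks. Holomorphy of
  the effective admittance comes from an exact formula for its increments as a bilinear energy of
  two solutions (\<open>effective_admittance_difference\<close>), together with continuity of the solution
  in \<open>s\<close> (\<open>solution_tendsto\<close>).

  On the real axis the admittances are real and of the same sign, and Dirichlet's principle makes
  the effective admittances of the truncated networks monotone in \<open>n\<close>: a potential of a truncated
  network, extended by zero, is a competitor in all larger ones. So they converge at every nonzero
  real \<open>s\<close>. A locally bounded sequence of holomorphic functions converging on a set with an
  accumulation point converges throughout a connected domain, to a holomorphic limit
  (\<open>vitali_porter\<close>). The complement of the segment is connected if \<open>S < \<infinity>\<close>; if \<open>S = \<infinity>\<close> it
  consists of two half-planes, each of which meets the real axis.
\<close>

section \<open>Tools from linear algebra and complex analysis\<close>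

lemma underdetermined_homogeneous_system:
  fixes A :: "'i \<Rightarrow> 'j \<Rightarrow> 'k::field"
  assumes "finite I" "finite J" "card I < card J"
  shows "\<exists>x. (\<exists>j\<in>J. x j \<noteq> 0) \<and> (\<forall>i\<in>I. (\<Sum>j\<in>J. A i j * x j) = 0)"
  using assms
proof (induction I arbitrary: J A rule: finite_induct)
  case empty
  then obtain j where "j \<in> J" by fastforce
  then show ?case by (intro exI[of _ "\<lambda>_. 1"]) auto
next
  case (insert i I)
  show ?case
  proof (cases "\<forall>j\<in>J. A i j = 0")
    case True
    obtain x where "\<exists>j\<in>J. x j \<noteq> 0" "\<forall>k\<in>I. (\<Sum>j\<in>J. A k j * x j) = 0"
      using insert.IH[of J A] insert.prems insert.hyps by auto
    with True show ?thesis by (intro exI[of _ x]) auto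
  next
    case False
    then obtain p where p: "p \<in> J" "A i p \<noteq> 0" by blast
    \<comment> \<open>Gaussian elimination of the unknown \<open>p\<close> by means of row \<open>i\<close>.\<close>
    define A' where "A' k j = A k j - A k p * A i j / A i p" for k j
    have "card I < card (J - {p})"
      using insert.prems insert.hyps p by simp
    then obtain y where y: "\<exists>j\<in>J - {p}. y j \<noteq> 0"
      "\<forall>k\<in>I. (\<Sum>j\<in>J - {p}. A' k j * y j) = 0"
      using insert.IH[of "J - {p}" A'] insert.prems by auto
    define yp where "yp = - (\<Sum>j\<in>J - {p}. A i j * y j) / A i p"
    define x where "x = y(p := yp)"
    have split: "(\<Sum>j\<in>J. A k j * x j) = A k p * yp + (\<Sum>j\<in>J - {p}. A k j * y j)" for k
    proof -
      have "(\<Sum>j\<in>J - {p}. A k j * x j) = (\<Sum>j\<in>J - {p}. A k j * y j)"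
        by (intro sum.cong) (auto simp: x_def)
      then show ?thesis
        using sum.remove[OF insert.prems(1) p(1), of "\<lambda>j. A k j * x j"] by (simp add: x_def)
    qed
    have "(\<Sum>j\<in>J. A k j * x j) = 0" if "k \<in> insert i I" for k
    proof (cases "k = i")
      case True
      then show ?thesis using p by (simp add: split yp_def)
    next
      case False
      then have "0 = (\<Sum>j\<in>J - {p}. A' k j * y j)" using y that by simp
      also have "\<dots> = (\<Sum>j\<in>J - {p}. A k j * y j)
          - A k p / A i p * (\<Sum>j\<in>J - {p}. A i j * y j)"
        by (simp add: A'_def sum_subtractf sum_distrib_left algebra_simps)
      also have "\<dots> = (\<Sum>j\<in>J. A k j * x j)" by (simp add: split yp_def)
      finally show ?thesis by simp
    qed
    moreover have "\<exists>j\<in>J. x j \<noteq> 0" using y by (auto simp: x_def)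
    ultimately show ?thesis by blast
  qed
qed

text \<open>Montel's theorem extracts one limit \<open>g\<close>. If the whole sequence failed to converge to \<open>g\<close> at
  some point, Montel's theorem would extract a second limit from a bad subsequence; the two limits
  agree on \<open>A\<close> and therefore, by the identity theorem, everywhere.\<close>

lemma vitali_porter:
  fixes f :: "nat \<Rightarrow> complex \<Rightarrow> complex"
  assumes U: "open U" "connected U"
    and hol: "\<And>n. f n holomorphic_on U"
    and bdd: "\<And>z. z \<in> U \<Longrightarrow> \<exists>M. \<forall>\<^sub>F w in nhds z. \<forall>n. norm (f n w) \<le> M"
    and A: "A \<subseteq> U" "\<xi> \<in> U" "\<xi> islimpt A"
    and conv: "\<And>z. z \<in> A \<Longrightarrow> convergent (\<lambda>n. f n z)"
  obtains g where "g holomorphic_on U" "\<And>z. z \<in> U \<Longrightarrow> (\<lambda>n. f n z) \<longlonglongrightarrow> g z"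
proof -
  have cbdd: "\<exists>M. \<forall>h\<in>range f. \<forall>z\<in>K. norm (h z) \<le> M" if K: "compact K" "K \<subseteq> U" for K
  proof -
    have "\<exists>W M. open W \<and> z \<in> W \<and> (\<forall>w\<in>W. \<forall>n. norm (f n w) \<le> M)" if "z \<in> K" for z
      using bdd[of z] that K unfolding eventually_nhds by blast
    then obtain W M where W: "\<And>z. z \<in> K \<Longrightarrow> open (W z) \<and> z \<in> W z"
      and M: "\<And>z w n. z \<in> K \<Longrightarrow> w \<in> W z \<Longrightarrow> norm (f n w) \<le> M z" by metis
    obtain D where D: "D \<subseteq> K" "finite D" "K \<subseteq> (\<Union>z\<in>D. W z)"
      using compactE_image[OF K(1), of K W] W by blast
    have "norm (f n w) \<le> Max (insert 0 (M ` D))" if w: "w \<in> K" for n w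
    proof -
      obtain z where "z \<in> D" "w \<in> W z" using D(3) w by blast
      then have "norm (f n w) \<le> M z" "M z \<in> insert 0 (M ` D)" using M D by auto
      then show ?thesis using Max_ge[of "insert 0 (M ` D)" "M z"] D(2)
        by (meson finite.insertI finite_imageI order_trans)
    qed
    then show ?thesis by auto
  qed
  have sub: "\<exists>g r. g holomorphic_on U \<and> strict_mono r \<and> (\<forall>z\<in>U. (\<lambda>n. f (k (r n)) z) \<longlonglongrightarrow> g z)"
    for k :: "nat \<Rightarrow> nat"
  proof (rule Montel[OF U(1), of "range f" "\<lambda>n. f (k n)"])
    show "\<exists>M. \<forall>h\<in>range f. \<forall>z\<in>K. norm (h z) \<le> M" if "compact K" "K \<subseteq> U" for K
      using cbdd that .
  next
    fix g r assume "g holomorphic_on U" "strict_mono (r :: nat \<Rightarrow> nat)"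
      "\<And>x. x \<in> U \<Longrightarrow> (\<lambda>n. f (k (r n)) x) \<longlonglongrightarrow> g x"
    then show ?thesis by blast
  qed (use hol in auto)
  obtain g r where g: "g holomorphic_on U" "strict_mono r" "\<And>z. z \<in> U \<Longrightarrow> (\<lambda>n. f (r n) z) \<longlonglongrightarrow> g z"
    using sub[of "\<lambda>n. n"] by blast
  have gA: "(\<lambda>n. f n z) \<longlonglongrightarrow> g z" if z: "z \<in> A" for z
  proof -
    obtain l where l: "(\<lambda>n. f n z) \<longlonglongrightarrow> l" using conv z by (auto simp: convergent_def)
    then have "(\<lambda>n. f (r n) z) \<longlonglongrightarrow> l"
      using LIMSEQ_subseq_LIMSEQ[OF l g(2)] by (simp add: o_def)
    then show ?thesis using l g(3)[of z] z A(1) LIMSEQ_unique by blast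
  qed
  have "(\<lambda>n. f n z) \<longlonglongrightarrow> g z" if z: "z \<in> U" for z
  proof (rule ccontr)
    assume "\<not> ?thesis"
    then obtain S where S: "open S" "g z \<in> S" "\<exists>\<^sub>F n in sequentially. f n z \<notin> S"
      by (auto simp: tendsto_def frequently_def)
    then obtain k :: "nat \<Rightarrow> nat" where k: "strict_mono k" "\<And>n. f (k n) z \<notin> S"
      unfolding frequently_sequentially
      using infinite_enumerate[of "{n. f n z \<notin> S}"]
      by (metis (mono_tags, lifting) infinite_nat_iff_unbounded_le mem_Collect_eq)
    obtain h q where h: "h holomorphic_on U" "strict_mono q" "\<And>z. z \<in> U \<Longrightarrow> (\<lambda>n. f (k (q n)) z) \<longlonglongrightarrow> h z"
      using sub[of k] by blast
    have kq: "strict_mono (\<lambda>n. k (q n))" using k(1) h(2) by (simp add: strict_mono_def)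
    have hg: "h x - g x = 0" if x: "x \<in> A" for x
    proof -
      have "(\<lambda>n. f (k (q n)) x) \<longlonglongrightarrow> g x"
        using LIMSEQ_subseq_LIMSEQ[OF gA[OF x] kq] by (simp add: o_def)
      then show ?thesis using h(3)[of x] x A(1) LIMSEQ_unique by (metis diff_self subsetD)
    qed
    have "(\<lambda>x. h x - g x) holomorphic_on U" using h(1) g(1) by (rule holomorphic_on_diff)
    then have "h z - g z = 0"
      using U A hg z by (rule analytic_continuation)
    then have "(\<lambda>n. f (k (q n)) z) \<longlonglongrightarrow> g z" using h(3)[OF z] by simp
    then have "\<forall>\<^sub>F n in sequentially. f (k (q n)) z \<in> S" using S by (simp add: tendsto_def)
    then show False using k(2) by simp
  qed
  with g(1) that show thesis by blast
qed

section \<open>The sector condition\<close>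

text \<open>For \<open>\<kappa> > 0\<close>: all admittances, rotated by \<open>w\<close>, lie in one closed sector properly contained in
  the right half-plane. The condition is stated for admittances, because these are the
  coefficients of the energy form.\<close>

definition sectorial ::
  "'v set set \<Rightarrow> ('v set \<Rightarrow> real) \<Rightarrow> ('v set \<Rightarrow> real) \<Rightarrow> ('v set \<Rightarrow> ereal)
    \<Rightarrow> complex \<Rightarrow> real \<Rightarrow> complex \<Rightarrow> bool" where
  "sectorial E R L C w \<kappa> s \<longleftrightarrow>
     (\<forall>e\<in>E. impedance R L C s e \<noteq> 0 \<and>
        \<kappa> * norm (1 / impedance R L C s e) \<le> Re (w * (1 / impedance R L C s e)))"

lemma sectorial_subset: "sectorial E R L C w \<kappa> s \<Longrightarrow> E' \<subseteq> E \<Longrightarrow> sectorial E' R L C w \<kappa> s"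
  by (auto simp: sectorial_def)

lemma sectorial_admittance:
  "sectorial E R L C w \<kappa> s \<Longrightarrow>
     \<kappa> * norm (admittance E R L C s x y) \<le> Re (w * admittance E R L C s x y)"
  unfolding sectorial_def admittance_def by (cases "{x, y} \<in> E") simp_all

lemma sectorial_admittance_nonzero:
  "sectorial E R L C w \<kappa> s \<Longrightarrow> {x, y} \<in> E \<Longrightarrow> admittance E R L C s x y \<noteq> 0"
  by (auto simp: sectorial_def admittance_def)

lemma admittance_field_differentiable:
  assumes "s \<noteq> 0" "{x, y} \<in> E \<Longrightarrow> impedance R L C s {x, y} \<noteq> 0"
  shows "(\<lambda>t. admittance E R L C t x y) field_differentiable at s"
proof (cases "{x, y} \<in> E")
  case True
  have "(\<lambda>t. 1 / (of_real (R {x, y}) + of_real (L {x, y}) * t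
      + of_real (inv_capacitance C {x, y}) / t)) field_differentiable at s"
    using assms True unfolding impedance_def
    by (intro derivative_intros field_differentiable_divide field_differentiable_add
        field_differentiable_mult field_differentiable_const field_differentiable_ident) auto
  with True show ?thesis by (simp add: admittance_def impedance_def)
qed (simp add: admittance_def)

section \<open>Energy and solvability of the Dirichlet problem\<close>

context finite_network
begin

abbreviation "\<rho> \<equiv> admittance E R L C"
abbreviation "\<Delta> \<equiv> laplacian V E R L C"
abbreviation "solves \<equiv> dirichlet_solution V E R L C a B"
abbreviation "\<P> s \<equiv> the (effective_admittance V E R L C a B s)"

text \<open>The energy is bilinear, not sesquilinear, so that it is symmetric and holomorphic in \<open>s\<close>; the
  coercive form is obtained by conjugating the second argument. The factor \<open>1 / 2\<close> compensates for
  every edge being counted in both directions.\<close>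

definition energy :: "complex \<Rightarrow> ('v \<Rightarrow> complex) \<Rightarrow> ('v \<Rightarrow> complex) \<Rightarrow> complex" where
  "energy s f g = (\<Sum>x\<in>V. \<Sum>y\<in>V. \<rho> s x y * (f y - f x) * (g y - g x)) / 2"

lemma energy_commute: "energy s f g = energy s g f"
  unfolding energy_def by (simp add: mult_ac)

lemma energy_diff_left: "energy s (\<lambda>x. f x - g x) h = energy s f h - energy s g h"
  unfolding energy_def diff_divide_distrib[symmetric] sum_subtractf[symmetric]
  by (intro arg_cong2[where f = "(/)"] sum.cong refl) (simp add: algebra_simps)

lemma energy_diff_right: "energy s h (\<lambda>x. f x - g x) = energy s h f - energy s h g"
  using energy_diff_left energy_commute by metis

lemma energy_green: "energy s f g = - (\<Sum>x\<in>V. g x * \<Delta> s f x)"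
proof -
  let ?S = "\<Sum>x\<in>V. \<Sum>y\<in>V. \<rho> s x y * (f y - f x) * g x"
  have "(\<Sum>x\<in>V. \<Sum>y\<in>V. \<rho> s x y * (f y - f x) * g y)
      = (\<Sum>x\<in>V. \<Sum>y\<in>V. \<rho> s y x * (f x - f y) * g x)"
    by (rule sum.swap)
  also have "\<dots> = - ?S"
    unfolding sum_negf[symmetric]
    by (intro sum.cong refl) (simp add: admittance_sym[of E R L C s] algebra_simps)
  finally have "(\<Sum>x\<in>V. \<Sum>y\<in>V. \<rho> s x y * (f y - f x) * (g y - g x)) = - 2 * ?S"
    by (simp add: right_diff_distrib sum_subtractf)
  moreover have "?S = (\<Sum>x\<in>V. g x * \<Delta> s f x)"
    unfolding laplacian_def sum_distrib_left by (intro sum.cong refl) (simp add: mult_ac)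
  ultimately show ?thesis by (simp add: energy_def)
qed

lemma effective_admittance_eq:
  assumes "solves s v"
  shows "effective_admittance V E R L C a B s = Some (- \<Delta> s v a)"
proof -
  have "input_current V E R L C a s v = - \<Delta> s v a"
    unfolding input_current_def laplacian_def sum_negf[symmetric] using assms
    by (intro sum.cong refl)
      (simp add: dirichlet_solution_def admittance_sym[of E R L C s a] algebra_simps)
  moreover have "solves s (SOME v. solves s v)" using someI[of "solves s", OF assms] .
  ultimately show ?thesis
    using input_current_unique[OF assms] assms by (auto simp: effective_admittance_def)
qed

text \<open>In Green's formula only the term at \<open>a\<close> survives: \<open>v\<close> is harmonic off \<open>B\<close> and \<open>a\<close>, and \<open>g\<close>
  vanishes on \<open>B\<close>.\<close>

lemma energy_solution:
  assumes v: "solves s v" and g: "\<forall>b\<in>B. g b = 0"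
  shows "energy s v g = g a * \<P> s"
proof -
  have "(\<Sum>x\<in>V. g x * \<Delta> s v x) = (\<Sum>x\<in>V. if x = a then g x * \<Delta> s v x else 0)"
    using assms by (intro sum.cong refl) (auto simp: dirichlet_solution_def)
  then show ?thesis
    using finite_V a_in_V effective_admittance_eq[OF v] by (simp add: energy_green)
qed

lemma energy_sectorial_lower_bound:
  assumes "sectorial E R L C w \<kappa> s"
  shows "\<kappa> * (\<Sum>x\<in>V. \<Sum>y\<in>V. norm (\<rho> s x y) * (norm (f y - f x))\<^sup>2) / 2
           \<le> Re (w * energy s f (\<lambda>x. cnj (f x)))"
proof -
  have "Re (w * energy s f (\<lambda>x. cnj (f x)))
      = (\<Sum>x\<in>V. \<Sum>y\<in>V. Re (w * \<rho> s x y) * (norm (f y - f x))\<^sup>2) / 2"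
  proof -
    have *: "\<rho> s x y * (f y - f x) * (cnj (f y) - cnj (f x))
        = \<rho> s x y * of_real ((norm (f y - f x))\<^sup>2)" for x y
      by (metis complex_cnj_diff complex_norm_square mult.assoc)
    have "w * energy s f (\<lambda>x. cnj (f x))
        = (\<Sum>x\<in>V. \<Sum>y\<in>V. w * \<rho> s x y * of_real ((norm (f y - f x))\<^sup>2)) / 2"
      unfolding energy_def * by (simp add: sum_distrib_left mult.assoc)
    moreover have "Re (z / 2) = Re z / 2" for z by simp
    moreover have "Re (z * of_real r) = Re z * r" for z r by simp
    ultimately show ?thesis by (simp only: Re_sum)
  qed
  moreover have "\<kappa> * (\<Sum>x\<in>V. \<Sum>y\<in>V. norm (\<rho> s x y) * (norm (f y - f x))\<^sup>2)
      \<le> (\<Sum>x\<in>V. \<Sum>y\<in>V. Re (w * \<rho> s x y) * (norm (f y - f x))\<^sup>2)"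
    unfolding sum_distrib_left mult.assoc[symmetric]
    by (intro sum_mono mult_right_mono sectorial_admittance assms) auto
  ultimately show ?thesis by simp
qed

text \<open>By coercivity \<open>h\<close> is constant along every edge; as the graph is connected, its value is that
  at a point of \<open>B\<close>.\<close>

lemma zero_energy_imp_zero:
  assumes s: "sectorial E R L C w \<kappa> s" "0 < \<kappa>"
    and h: "energy s h (\<lambda>x. cnj (h x)) = 0" "\<forall>b\<in>B. h b = 0" and x: "x \<in> V"
  shows "h x = 0"
proof -
  let ?e = "\<lambda>x y. norm (\<rho> s x y) * (norm (h y - h x))\<^sup>2"
  have "(\<Sum>x\<in>V. \<Sum>y\<in>V. ?e x y) \<le> 0"
    using energy_sectorial_lower_bound[OF s(1), of h] h(1) s(2)
    by (simp add: mult_le_0_iff)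
  moreover have "0 \<le> (\<Sum>x\<in>V. \<Sum>y\<in>V. ?e x y)" by (intro sum_nonneg) auto
  ultimately have z: "(\<Sum>x\<in>V. \<Sum>y\<in>V. ?e x y) = 0" by simp
  have edge: "h y = h x" if xy: "(x, y) \<in> adjacency E" for x y
  proof -
    have e: "{x, y} \<in> E" using xy by (simp add: adjacency_def)
    then have "x \<in> V" "y \<in> V" using edges by (fastforce simp: doubleton_eq_iff)+
    then have "?e x y = 0"
      using z finite_V by (simp add: sum_nonneg_eq_0_iff sum_nonneg)
    then show ?thesis using sectorial_admittance_nonzero[OF s(1) e] by simp
  qed
  obtain b where b: "b \<in> B" using B_nonempty by blast
  then have "(b, x) \<in> (adjacency E)\<^sup>*" using connected x B_subset by blast
  then have "h x = h b" by (induction rule: rtrancl_induct) (auto dest: edge)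
  then show ?thesis using b h(2) by simp
qed

text \<open>Harmonicity on the interior gives one equation fewer than there are values of \<open>f\<close> on the
  interior and at \<open>a\<close>, so there is a nonzero \<open>f\<close> vanishing on \<open>B\<close>. If \<open>f a\<close> were zero, \<open>f\<close> would have
  zero energy; hence it can be normalised to \<open>1\<close> at \<open>a\<close>.\<close>

lemma ex_solution:
  assumes s: "sectorial E R L C w \<kappa> s" "0 < \<kappa>"
  shows "\<exists>v. solves s v"
proof -
  define I where "I = V - (B \<union> {a})"
  define J where "J = V - B"
  \<comment> \<open>The matrix of the Laplacian.\<close>
  define A where "A x y = \<rho> s x y - (if x = y then \<Sum>z\<in>V. \<rho> s x z else 0)" for x y
  have J: "J = insert a I" using a_in_V a_notin_B by (auto simp: I_def J_def)
  have fin: "finite I" "finite J" using finite_V by (auto simp: I_def J_def)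
  moreover have "card I < card J" using J fin by (simp add: I_def)
  ultimately obtain u where u: "\<exists>x\<in>J. u x \<noteq> 0" "\<forall>x\<in>I. (\<Sum>y\<in>J. A x y * u y) = 0"
    using underdetermined_homogeneous_system[of I J A] by blast
  define f where "f x = (if x \<in> J then u x else 0)" for x
  have fB: "\<forall>b\<in>B. f b = 0" by (simp add: f_def J_def)
  have lap: "\<Delta> s f x = 0" if x: "x \<in> I" for x
  proof -
    have xV: "x \<in> V" using x by (simp add: I_def)
    have "(\<Sum>y\<in>J. A x y * u y) = (\<Sum>y\<in>V. A x y * f y)"
      using finite_V by (intro sum.mono_neutral_cong_left) (auto simp: J_def f_def)
    also have "\<dots> = (\<Sum>y\<in>V. \<rho> s x y * f y) - (\<Sum>y\<in>V. if x = y then (\<Sum>z\<in>V. \<rho> s x z) * f y else 0)"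
      unfolding sum_subtractf[symmetric] by (intro sum.cong refl) (simp add: A_def algebra_simps)
    also have "\<dots> = \<Delta> s f x"
      using finite_V xV
      by (simp add: laplacian_def sum_subtractf algebra_simps sum_distrib_left)
    finally show ?thesis using u(2) x by simp
  qed
  have "f a \<noteq> 0"
  proof
    assume fa: "f a = 0"
    have "(\<Sum>x\<in>V. cnj (f x) * \<Delta> s f x) = 0"
      using lap fB fa by (intro sum.neutral) (auto simp: I_def)
    then have "energy s f (\<lambda>x. cnj (f x)) = 0" by (simp add: energy_green)
    then have "\<forall>x\<in>V. f x = 0" using zero_energy_imp_zero[OF s] fB by blast
    then show False using u(1) by (auto simp: f_def J_def)
  qed
  moreover have "\<Delta> s (\<lambda>x. f x / f a) x = \<Delta> s f x / f a" for x
    by (simp add: laplacian_def sum_divide_distrib diff_divide_distrib[symmetric])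
  ultimately have "solves s (\<lambda>x. f x / f a)"
    using lap fB by (auto simp: dirichlet_solution_def I_def)
  then show ?thesis by blast
qed

section \<open>Effective admittance: bound and Dirichlet principle\<close>

lemma solution_energy:
  assumes "solves s v"
  shows "energy s v (\<lambda>x. cnj (v x)) = \<P> s"
  using energy_solution[OF assms, of "\<lambda>x. cnj (v x)"] assms by (simp add: dirichlet_solution_def)

text \<open>The energy of the solution with weights \<open>\<bar>\<rho>\<bar>\<close> is at most \<open>\<bar>w\<bar> / \<kappa>\<close> times the modulus of the
  effective admittance. Conversely, the latter is the current through the edges at \<open>a\<close>, which is linear in the voltage
  drops. Splitting each drop by Young's inequality with parameter \<open>K\<close> produces a quadratic part that
  is absorbed on the left. The estimate does not depend on the size of the network.\<close>

lemma effective_admittance_bound: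
  assumes s: "sectorial E R L C w \<kappa> s" "0 < \<kappa>" and K: "norm w \<le> \<kappa> * K" "0 < K"
  shows "norm (\<P> s) \<le> 2 * K * (\<Sum>y\<in>V. norm (\<rho> s a y))"
proof -
  obtain v where v: "solves s v" using ex_solution[OF s] by blast
  define M where "M = (\<Sum>y\<in>V. norm (\<rho> s a y))"
  define Q where "Q = (\<Sum>x\<in>V. \<Sum>y\<in>V. norm (\<rho> s x y) * (norm (v y - v x))\<^sup>2)"
  have "\<kappa> * Q / 2 \<le> Re (w * \<P> s)"
    using energy_sectorial_lower_bound[OF s(1), of v] solution_energy[OF v] by (simp add: Q_def)
  also have "\<dots> \<le> norm w * norm (\<P> s)" by (metis complex_Re_le_cmod norm_mult)
  also have "\<dots> \<le> \<kappa> * K * norm (\<P> s)" using K(1) by (rule mult_right_mono) simp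
  finally have Q: "Q \<le> 2 * K * norm (\<P> s)" using s(2) by simp
  have young: "b \<le> K + b\<^sup>2 / (4 * K)" for b :: real
  proof -
    have "0 \<le> (b - 2 * K)\<^sup>2 / (4 * K)" using K(2) by simp
    then show ?thesis using K(2) by (simp add: power2_eq_square field_simps)
  qed
  have "norm (\<P> s) = norm (\<Sum>y\<in>V. (v y - v a) * \<rho> s a y)"
    using effective_admittance_eq[OF v] by (simp add: laplacian_def)
  also have "\<dots> \<le> (\<Sum>y\<in>V. norm (v y - v a) * norm (\<rho> s a y))"
    by (rule order_trans[OF norm_sum]) (simp add: norm_mult)
  also have "\<dots> \<le> (\<Sum>y\<in>V. (K + (norm (v y - v a))\<^sup>2 / (4 * K)) * norm (\<rho> s a y))"
    by (intro sum_mono mult_right_mono young) simp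
  also have "\<dots> = K * M + (\<Sum>y\<in>V. norm (\<rho> s a y) * (norm (v y - v a))\<^sup>2) / (4 * K)"
    unfolding M_def sum_distrib_left sum_divide_distrib sum.distrib[symmetric]
    by (intro sum.cong refl) (simp add: algebra_simps)
  also have "\<dots> \<le> K * M + Q / (4 * K)"
    unfolding Q_def using finite_V a_in_V K(2)
    by (intro add_left_mono divide_right_mono
        member_le_sum[of a V "\<lambda>x. \<Sum>y\<in>V. norm (\<rho> s x y) * (norm (v y - v x))\<^sup>2"])
      (auto intro: sum_nonneg)
  also have "\<dots> \<le> K * M + norm (\<P> s) / 2"
    using Q K(2) by (simp add: field_simps)
  finally show ?thesis by (simp add: M_def)
qed

lemma cnj_energy_real:
  assumes "\<And>x y. Im (\<rho> s x y) = 0"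
  shows "cnj (energy s f g) = energy s (\<lambda>x. cnj (f x)) (\<lambda>x. cnj (g x))"
proof -
  have "cnj (\<rho> s x y) = \<rho> s x y" for x y using assms by (simp add: complex_eq_iff)
  then show ?thesis by (simp add: energy_def)
qed

text \<open>For real coefficients the energy of \<open>f - v\<close>, with \<open>v\<close> the solution, is the energy of \<open>f\<close> minus the
  effective admittance, because both mixed terms equal the effective admittance.
  The sign of \<open>w\<close> is left open so that negative frequencies are covered.\<close>

lemma dirichlet_principle:
  assumes s: "sectorial E R L C (of_real w) \<kappa> s" "0 < \<kappa>"
    and real: "\<And>x y. Im (\<rho> s x y) = 0"
    and f: "f a = 1" "\<forall>b\<in>B. f b = 0"
  shows "Im (\<P> s) = 0" and "w * Re (\<P> s) \<le> w * Re (energy s f (\<lambda>x. cnj (f x)))"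
proof -
  obtain v where v: "solves s v" using ex_solution[OF s] by blast
  have vv: "energy s v (\<lambda>x. cnj (v x)) = \<P> s" using solution_energy[OF v] .
  have vf: "energy s v (\<lambda>x. cnj (f x)) = \<P> s"
    using energy_solution[OF v, of "\<lambda>x. cnj (f x)"] f by simp
  have P: "cnj (\<P> s) = \<P> s"
    using cnj_energy_real[OF real, of v "\<lambda>x. cnj (v x)"] vv energy_commute by simp
  then show "Im (\<P> s) = 0" by (simp add: complex_eq_iff)
  have fv: "energy s f (\<lambda>x. cnj (v x)) = \<P> s"
    using cnj_energy_real[OF real, of v "\<lambda>x. cnj (f x)"] vf P energy_commute by simp
  let ?h = "\<lambda>x. f x - v x"
  have "energy s ?h (\<lambda>x. cnj (?h x)) = energy s f (\<lambda>x. cnj (f x)) - \<P> s"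
    by (simp add: energy_diff_left energy_diff_right vv vf fv)
  moreover have "0 \<le> Re (of_real w * energy s ?h (\<lambda>x. cnj (?h x)))"
  proof (rule order_trans[OF _ energy_sectorial_lower_bound[OF s(1)]])
    show "0 \<le> \<kappa> * (\<Sum>x\<in>V. \<Sum>y\<in>V. norm (\<rho> s x y) * (norm (?h y - ?h x))\<^sup>2) / 2"
      using s(2) by (intro divide_nonneg_nonneg mult_nonneg_nonneg sum_nonneg) auto
  qed
  ultimately have "0 \<le> Re (of_real w * (energy s f (\<lambda>x. cnj (f x)) - \<P> s))"
    by (simp only:)
  then show "w * Re (\<P> s) \<le> w * Re (energy s f (\<lambda>x. cnj (f x)))"
    by (simp add: right_diff_distrib)
qed

section \<open>Effective admittance: dependence on the frequency\<close>

text \<open>The difference \<open>h\<close> of the two solutions vanishes on \<open>B\<close> and at \<open>a\<close>, so its energy at \<open>s\<close>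
  against its own conjugate equals the energy of \<open>u\<close> against the conjugate of \<open>h\<close>, taken with the
  coefficients \<open>\<rho> t - \<rho> s\<close>. Young's inequality
  on each edge absorbs \<open>h\<close> into the coercive side. Off the edges, where the denominator vanishes,
  both sides have value zero.\<close>

lemma solution_perturbation:
  assumes s: "sectorial E R L C w \<kappa> s" "0 < \<kappa>"
    and v: "solves s v" and u: "solves t u"
  shows "(\<Sum>x\<in>V. \<Sum>y\<in>V. norm (\<rho> s x y) * (norm ((v y - u y) - (v x - u x)))\<^sup>2)
    \<le> (norm w / \<kappa>)\<^sup>2 * (\<Sum>x\<in>V. \<Sum>y\<in>V.
          (norm (\<rho> s x y - \<rho> t x y))\<^sup>2 * (norm (u y - u x))\<^sup>2 / norm (\<rho> s x y))"
proof -
  let ?h = "\<lambda>x. v x - u x"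
  define X where "X x y = norm (\<rho> s x y) * (norm (?h y - ?h x))\<^sup>2" for x y
  define Y where "Y x y = (norm (\<rho> s x y - \<rho> t x y))\<^sup>2 * (norm (u y - u x))\<^sup>2 / norm (\<rho> s x y)" for x y
  have young: "norm w * (norm (\<rho> s x y - \<rho> t x y) * norm (u y - u x) * norm (?h y - ?h x))
      \<le> \<kappa> / 2 * X x y + (norm w)\<^sup>2 / (2 * \<kappa>) * Y x y" for x y
  proof (cases "{x, y} \<in> E")
    case True
    define p b q where "p = norm (\<rho> s x y)" and "b = norm (?h y - ?h x)"
      and "q = norm w * (norm (\<rho> s x y - \<rho> t x y) * norm (u y - u x))"
    have p: "0 < p" using sectorial_admittance_nonzero[OF s(1) True] by (simp add: p_def)
    have "0 \<le> (\<kappa> * p * b - q)\<^sup>2 / (2 * \<kappa> * p)" using p s(2) by simp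
    also have "\<dots> = \<kappa> / 2 * (p * b\<^sup>2) + q\<^sup>2 / (2 * \<kappa> * p) - q * b"
      using p s(2) by (simp add: power2_eq_square field_simps)
    finally have "q * b \<le> \<kappa> / 2 * (p * b\<^sup>2) + q\<^sup>2 / (2 * \<kappa> * p)" by simp
    moreover have "q\<^sup>2 / (2 * \<kappa> * p) = (norm w)\<^sup>2 / (2 * \<kappa>) * Y x y"
      by (simp add: q_def Y_def p_def power_mult_distrib)
    ultimately show ?thesis by (simp add: X_def p_def b_def q_def mult_ac)
  next
    case False
    then show ?thesis by (simp add: admittance_def X_def Y_def)
  qed
  have hB: "\<forall>b\<in>B. ?h b = 0" and ha: "?h a = 0" using v u by (auto simp: dirichlet_solution_def)
  have "energy s v (\<lambda>x. cnj (?h x)) = 0"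
    using energy_solution[OF v, of "\<lambda>x. cnj (?h x)"] hB ha by simp
  then have "energy s ?h (\<lambda>x. cnj (?h x)) = - energy s u (\<lambda>x. cnj (?h x))"
    using energy_diff_left[of s v u "\<lambda>x. cnj (?h x)"] by simp
  also have "\<dots> = energy t u (\<lambda>x. cnj (?h x)) - energy s u (\<lambda>x. cnj (?h x))"
    using energy_solution[OF u, of "\<lambda>x. cnj (?h x)"] hB ha by simp
  also have "\<dots> = - (\<Sum>x\<in>V. \<Sum>y\<in>V.
      (\<rho> s x y - \<rho> t x y) * (u y - u x) * cnj (?h y - ?h x)) / 2"
    unfolding energy_def diff_divide_distrib[symmetric] sum_subtractf[symmetric] sum_negf[symmetric]
    by (intro arg_cong2[where f = "(/)"] sum.cong refl) (simp add: algebra_simps)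
  finally have eq: "norm (energy s ?h (\<lambda>x. cnj (?h x))) = norm (\<Sum>x\<in>V. \<Sum>y\<in>V.
      (\<rho> s x y - \<rho> t x y) * (u y - u x) * cnj (?h y - ?h x)) / 2"
    by (simp add: norm_divide)
  have "\<kappa> * (\<Sum>x\<in>V. \<Sum>y\<in>V. X x y) / 2 \<le> Re (w * energy s ?h (\<lambda>x. cnj (?h x)))"
    unfolding X_def by (rule energy_sectorial_lower_bound[OF s(1)])
  also have "\<dots> \<le> norm w * norm (energy s ?h (\<lambda>x. cnj (?h x)))"
    by (metis complex_Re_le_cmod norm_mult)
  also have "\<dots> \<le> norm w * ((\<Sum>x\<in>V. \<Sum>y\<in>V.
      norm (\<rho> s x y - \<rho> t x y) * norm (u y - u x) * norm (?h y - ?h x)) / 2)"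
    unfolding eq
    by (intro mult_left_mono divide_right_mono order_trans[OF norm_sum] sum_mono)
      (auto simp: norm_mult simp del: complex_cnj_diff)
  also have "\<dots> = (\<Sum>x\<in>V. \<Sum>y\<in>V.
      norm w * (norm (\<rho> s x y - \<rho> t x y) * norm (u y - u x) * norm (?h y - ?h x))) / 2"
    by (simp add: sum_distrib_left)
  also have "\<dots> \<le> (\<Sum>x\<in>V. \<Sum>y\<in>V. \<kappa> / 2 * X x y + (norm w)\<^sup>2 / (2 * \<kappa>) * Y x y) / 2"
    by (intro divide_right_mono sum_mono young) simp
  also have "\<dots> = (\<kappa> / 2 * (\<Sum>x\<in>V. \<Sum>y\<in>V. X x y)
      + (norm w)\<^sup>2 / (2 * \<kappa>) * (\<Sum>x\<in>V. \<Sum>y\<in>V. Y x y)) / 2"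
    by (simp add: sum.distrib sum_distrib_left)
  finally have "(\<Sum>x\<in>V. \<Sum>y\<in>V. X x y) \<le> (norm w / \<kappa>)\<^sup>2 * (\<Sum>x\<in>V. \<Sum>y\<in>V. Y x y)"
    using s(2) by (simp add: field_simps power2_eq_square)
  then show ?thesis by (simp add: X_def Y_def)
qed

text \<open>Each of the two solutions is tested against the other one; by symmetry of the energy both
  results involve the same products of voltage drops.\<close>

lemma effective_admittance_difference:
  assumes v: "solves s v" and u: "solves t u"
  shows "\<P> s - \<P> t = (\<Sum>x\<in>V. \<Sum>y\<in>V. (\<rho> s x y - \<rho> t x y) * (v y - v x) * (u y - u x)) / 2"
proof -
  have "\<P> s = energy s v u" "\<P> t = energy t v u"
    using energy_solution[OF v, of u] energy_solution[OF u, of v] energy_commute[of t] v u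
    by (auto simp: dirichlet_solution_def)
  then show ?thesis
    by (simp add: energy_def diff_divide_distrib[symmetric] sum_subtractf[symmetric] algebra_simps)
qed

text \<open>By \<open>solution_perturbation\<close> the change of the voltage drop tends to zero on every edge. The
  potentials themselves follow along a path from \<open>B\<close>, where they are fixed.\<close>

lemma solution_tendsto:
  assumes t: "t \<noteq> 0" and \<kappa>: "0 < \<kappa>" and sec: "\<forall>\<^sub>F s in nhds t. sectorial E R L C w \<kappa> s"
    and v: "\<And>s. sectorial E R L C w \<kappa> s \<Longrightarrow> solves s (v s)" and x: "x \<in> V"
  shows "((\<lambda>s. v s x) \<longlongrightarrow> v t x) (at t)"
proof -
  have sect: "sectorial E R L C w \<kappa> t" using sec by (rule eventually_nhds_x_imp_x)
  have ev: "\<forall>\<^sub>F s in at t. sectorial E R L C w \<kappa> s"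
    using sec by (simp add: eventually_nhds_conv_at)
  have rho: "((\<lambda>s. \<rho> s x y) \<longlongrightarrow> \<rho> t x y) (at t)" for x y
    using admittance_field_differentiable[of t x y E R L C] t sect
    by (intro isContD field_differentiable_imp_continuous_at) (auto simp: sectorial_def)
  let ?h = "\<lambda>s x. v s x - v t x"
  define F where "F s = (norm w / \<kappa>)\<^sup>2 * (\<Sum>x\<in>V. \<Sum>y\<in>V.
      (norm (\<rho> s x y - \<rho> t x y))\<^sup>2 * (norm (v t y - v t x))\<^sup>2 / norm (\<rho> s x y))" for s
  have "((\<lambda>s. (norm (\<rho> s x y - \<rho> t x y))\<^sup>2 * (norm (v t y - v t x))\<^sup>2 / norm (\<rho> s x y)) \<longlongrightarrow> 0) (at t)"
    for x y
  proof (cases "{x, y} \<in> E")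
    case True
    then have "\<rho> t x y \<noteq> 0" by (rule sectorial_admittance_nonzero[OF sect])
    then have "((\<lambda>s. (norm (\<rho> s x y - \<rho> t x y))\<^sup>2 * (norm (v t y - v t x))\<^sup>2 / norm (\<rho> s x y))
        \<longlongrightarrow> (norm (\<rho> t x y - \<rho> t x y))\<^sup>2 * (norm (v t y - v t x))\<^sup>2 / norm (\<rho> t x y)) (at t)"
      by (intro tendsto_divide tendsto_mult tendsto_power tendsto_norm tendsto_diff tendsto_const rho) auto
    then show ?thesis by simp
  qed (simp add: admittance_def)
  then have F: "(F \<longlongrightarrow> 0) (at t)"
    unfolding F_def by (intro tendsto_mult_right_zero tendsto_null_sum)
  have edge: "((\<lambda>s. ?h s y - ?h s x) \<longlongrightarrow> 0) (at t)" if e: "{x, y} \<in> E" for x y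
  proof -
    have xy: "x \<in> V" "y \<in> V" using e edges by (fastforce simp: doubleton_eq_iff)+
    have lim: "((\<lambda>s. F s / norm (\<rho> s x y)) \<longlongrightarrow> 0 / norm (\<rho> t x y)) (at t)"
      using sectorial_admittance_nonzero[OF sect e] by (intro tendsto_divide tendsto_norm F rho) auto
    have le: "\<forall>\<^sub>F s in at t. norm ((norm (?h s y - ?h s x))\<^sup>2) \<le> F s / norm (\<rho> s x y)"
      using ev
    proof eventually_elim
      case (elim s)
      let ?X = "\<lambda>x y. norm (\<rho> s x y) * (norm (?h s y - ?h s x))\<^sup>2"
      have "?X x y \<le> (\<Sum>y\<in>V. ?X x y)"
        using xy finite_V by (intro member_le_sum[of y V "?X x"]) auto
      also have "\<dots> \<le> (\<Sum>x\<in>V. \<Sum>y\<in>V. ?X x y)"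
        using xy finite_V
        by (intro member_le_sum[of x V "\<lambda>x. \<Sum>y\<in>V. ?X x y"]) (auto intro: sum_nonneg)
      also have "\<dots> \<le> F s"
        unfolding F_def by (rule solution_perturbation[OF elim \<kappa> v[OF elim] v[OF sect]])
      finally show ?case
        using sectorial_admittance_nonzero[OF elim e] by (simp add: field_simps)
    qed
    have "((\<lambda>s. (norm (?h s y - ?h s x))\<^sup>2) \<longlongrightarrow> 0) (at t)"
      by (rule Lim_null_comparison[OF le]) (use lim in simp)
    then have "((\<lambda>s. norm (?h s y - ?h s x)) \<longlongrightarrow> 0) (at t)"
      using power_tendsto_0_iff[of 2 "\<lambda>s. norm (?h s y - ?h s x)"] by simp
    then show ?thesis by (rule tendsto_norm_zero_cancel)
  qed
  obtain b where b: "b \<in> B" using B_nonempty by blast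
  then have "(b, x) \<in> (adjacency E)\<^sup>*" using connected x B_subset by blast
  then have "((\<lambda>s. ?h s x) \<longlongrightarrow> 0) (at t)"
  proof (induction rule: rtrancl_induct)
    case base
    have "\<forall>\<^sub>F s in at t. ?h s b = 0"
      using ev
    proof eventually_elim
      case (elim s)
      then show ?case using v[OF elim] v[OF sect] b by (simp add: dirichlet_solution_def)
    qed
    then show ?case by (rule tendsto_eventually)
  next
    case (step y z)
    then have "((\<lambda>s. ?h s y + (?h s z - ?h s y)) \<longlongrightarrow> 0 + 0) (at t)"
      by (intro tendsto_add edge) (auto simp: adjacency_def)
    then show ?case by simp
  qed
  then show ?thesis by (simp add: LIM_zero_iff)
qed

text \<open>In the increment formula, divided by \<open>s - t\<close>, only the difference quotients of the admittances
  are singular, and their limits are derivatives; the solutions merely have to be continuous.\<close>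

lemma effective_admittance_field_differentiable:
  assumes t: "t \<noteq> 0" and \<kappa>: "0 < \<kappa>" and sec: "\<forall>\<^sub>F s in nhds t. sectorial E R L C w \<kappa> s"
  shows "(\<lambda>s. \<P> s) field_differentiable at t"
proof -
  define v where "v s = (SOME v. solves s v)" for s
  have v: "solves s (v s)" if "sectorial E R L C w \<kappa> s" for s
    unfolding v_def using ex_solution[OF that \<kappa>] by (rule someI_ex)
  have sect: "sectorial E R L C w \<kappa> t" using sec by (rule eventually_nhds_x_imp_x)
  have "\<exists>d. ((\<lambda>s. \<rho> s x y) has_field_derivative d) (at t)" for x y
    using admittance_field_differentiable[of t x y E R L C] t sect
    by (auto simp: sectorial_def field_differentiable_def)
  then obtain d where d: "\<And>x y. ((\<lambda>s. \<rho> s x y) has_field_derivative d x y) (at t)" by metis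
  define D where "D = (\<Sum>x\<in>V. \<Sum>y\<in>V. d x y * (v t y - v t x) * (v t y - v t x)) / 2"
  have "((\<lambda>s. (\<Sum>x\<in>V. \<Sum>y\<in>V. (\<rho> s x y - \<rho> t x y) / (s - t) * (v s y - v s x) * (v t y - v t x)) / 2)
      \<longlongrightarrow> D) (at t)"
    unfolding D_def
    by (intro tendsto_divide tendsto_sum tendsto_mult tendsto_diff tendsto_const
        solution_tendsto[OF t \<kappa> sec v] d[unfolded has_field_derivative_iff]) auto
  moreover have "\<forall>\<^sub>F s in at t.
      (\<Sum>x\<in>V. \<Sum>y\<in>V. (\<rho> s x y - \<rho> t x y) / (s - t) * (v s y - v s x) * (v t y - v t x)) / 2
      = (\<P> s - \<P> t) / (s - t)"
  proof -
    have ev: "\<forall>\<^sub>F s in at t. sectorial E R L C w \<kappa> s"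
      using sec by (simp add: eventually_nhds_conv_at)
    show ?thesis
      using ev by eventually_elim
        (simp add: effective_admittance_difference[OF v v] sect sum_divide_distrib mult_ac)
  qed
  ultimately have "((\<lambda>s. (\<P> s - \<P> t) / (s - t)) \<longlongrightarrow> D) (at t)"
    by (rule Lim_transform_eventually)
  then show ?thesis by (auto simp: field_differentiable_def has_field_derivative_iff)
qed

end

section \<open>Frequencies off the exceptional segment\<close>

text \<open>It is enough to control the two generators: their strict inequalities persist nearby by
  continuity, and the inequality with a fixed \<open>\<kappa>\<close> passes to nonnegative combinations because the
  norm is convex.\<close>

lemma cone_uniformly_sectorial:
  fixes p q :: "complex \<Rightarrow> complex"
  assumes cont: "isCont p t" "isCont q t"
    and pos: "0 < Re (w * p t)" "0 < Re (w * q t)"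
  shows "\<exists>\<kappa>>0. \<forall>\<^sub>F s in nhds t. \<forall>\<alpha> \<beta>. 0 \<le> \<alpha> \<longrightarrow> 0 \<le> \<beta> \<longrightarrow> 0 < \<alpha> + \<beta> \<longrightarrow>
           (let z = of_real \<alpha> * p s + of_real \<beta> * q s
            in z \<noteq> 0 \<and> \<kappa> * norm z \<le> Re (w * z))"
proof -
  define \<kappa> where "\<kappa> = min (Re (w * p t)) (Re (w * q t)) / (1 + norm (p t) + norm (q t))"
  have d: "0 < 1 + norm (p t) + norm (q t)" by (simp add: add_pos_nonneg)
  then have \<kappa>: "0 < \<kappa>" using pos by (simp add: \<kappa>_def)
  have "\<kappa> * (1 + norm (p t) + norm (q t)) = min (Re (w * p t)) (Re (w * q t))"
    using d by (simp add: \<kappa>_def)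
  moreover have "\<kappa> * norm (p t) < \<kappa> * (1 + norm (p t) + norm (q t))"
    "\<kappa> * norm (q t) < \<kappa> * (1 + norm (p t) + norm (q t))"
    using \<kappa> norm_ge_zero[of "p t"] norm_ge_zero[of "q t"]
    by (auto intro!: mult_strict_left_mono simp: add_pos_nonneg)
  ultimately have "0 < Re (w * p t) - \<kappa> * norm (p t)" "0 < Re (w * q t) - \<kappa> * norm (q t)"
    by linarith+
  moreover have "((\<lambda>s. Re (w * f s) - \<kappa> * norm (f s)) \<longlongrightarrow> Re (w * f t) - \<kappa> * norm (f t)) (nhds t)"
    if "isCont f t" for f :: "complex \<Rightarrow> complex"
  proof -
    have "(f \<longlongrightarrow> f t) (nhds t)"
      using that by (simp add: isCont_def tendsto_at_iff_tendsto_nhds)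
    then show ?thesis
      by (intro tendsto_diff tendsto_Re tendsto_mult tendsto_const tendsto_norm)
  qed
  ultimately have "\<forall>\<^sub>F s in nhds t. 0 < Re (w * p s) - \<kappa> * norm (p s)"
    "\<forall>\<^sub>F s in nhds t. 0 < Re (w * q s) - \<kappa> * norm (q s)"
    using cont order_tendstoD(1) by blast+
  then have "\<forall>\<^sub>F s in nhds t. \<forall>\<alpha> \<beta>. 0 \<le> \<alpha> \<longrightarrow> 0 \<le> \<beta> \<longrightarrow> 0 < \<alpha> + \<beta> \<longrightarrow>
      (let z = of_real \<alpha> * p s + of_real \<beta> * q s in z \<noteq> 0 \<and> \<kappa> * norm z \<le> Re (w * z))"
  proof eventually_elim
    case (elim s)
    show ?case
    proof (intro allI impI)
      fix \<alpha> \<beta> :: real assume ab: "0 \<le> \<alpha>" "0 \<le> \<beta>" "0 < \<alpha> + \<beta>"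
      define z where "z = of_real \<alpha> * p s + of_real \<beta> * q s"
      have "norm z \<le> \<alpha> * norm (p s) + \<beta> * norm (q s)"
        unfolding z_def by (rule order_trans[OF norm_triangle_ineq]) (simp add: norm_mult ab)
      then have "\<kappa> * norm z \<le> \<kappa> * (\<alpha> * norm (p s) + \<beta> * norm (q s))"
        using \<kappa> by (intro mult_left_mono) auto
      also have "\<dots> = \<alpha> * (\<kappa> * norm (p s)) + \<beta> * (\<kappa> * norm (q s))"
        by (simp add: algebra_simps)
      also have "\<dots> < \<alpha> * Re (w * p s) + \<beta> * Re (w * q s)"
      proof (cases "0 < \<alpha>")
        case True
        then show ?thesis using elim ab
          by (intro add_less_le_mono mult_strict_left_mono mult_left_mono) auto
      next
        case False
        then have "\<alpha> = 0" "0 < \<beta>" using ab by auto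
        then show ?thesis using elim by simp
      qed
      also have "\<dots> = Re (w * z)"
      proof -
        have "w * z = of_real \<alpha> * (w * p s) + of_real \<beta> * (w * q s)"
          by (simp add: z_def algebra_simps)
        then show ?thesis by simp
      qed
      finally have "\<kappa> * norm z < Re (w * z)" .
      then have "z \<noteq> 0 \<and> \<kappa> * norm z \<le> Re (w * z)" using \<kappa> by auto
      then show "let z = of_real \<alpha> * p s + of_real \<beta> * q s in z \<noteq> 0 \<and> \<kappa> * norm z \<le> Re (w * z)"
        by (simp add: z_def)
    qed
  qed
  with \<kappa> show ?thesis by blast
qed

text \<open>Inversion reflects a sector with vertex \<open>0\<close> in the real axis; this turns \<open>w\<close> into its conjugate
  and keeps \<open>\<kappa>\<close>. With it, estimates on impedances pass to admittances.\<close>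

lemma sectorial_inverse:
  fixes z w :: complex
  assumes "z \<noteq> 0" "\<kappa> * norm z \<le> Re (w * z)"
  shows "\<kappa> * norm (1 / z) \<le> Re (cnj w * (1 / z))"
proof -
  have "Re (cnj w * (1 / z)) = Re (w * z) / (norm z)\<^sup>2"
    by (simp add: Re_divide cmod_power2)
  moreover have "\<kappa> * norm (1 / z) = \<kappa> * norm z / (norm z)\<^sup>2"
    using assms(1) by (simp add: norm_divide power2_eq_square)
  ultimately show ?thesis using assms(2) by (simp add: divide_right_mono)
qed

lemma closed_imaginary_segment: "closed (imaginary_segment S)"
  by (auto simp: imaginary_segment_def intro!: closed_Collect_eq continuous_on_Re)

lemma zero_in_imaginary_segment: "0 \<in> imaginary_segment S"
proof (cases "S = \<infinity>")
  case False
  have "(0::complex) = midpoint (- x) x" for x by (simp add: midpoint_def)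
  with False show ?thesis
    by (metis imaginary_segment_def midpoint_in_closed_segment mult_minus_left)
qed (simp add: imaginary_segment_def)

lemma Re_imaginary_segment: "z \<in> imaginary_segment S \<Longrightarrow> Re z = 0"
  by (auto simp: imaginary_segment_def closed_segment_def split: if_splits)

lemma sqrt_negative_in_imaginary_segment:
  assumes "S \<noteq> \<infinity>" "z\<^sup>2 = of_real (- r)" "0 \<le> r" "r \<le> real_of_ereal S"
  shows "z \<in> imaginary_segment S"
proof -
  define m where "m = sqrt (real_of_ereal S)"
  have "z\<^sup>2 = (\<i> * of_real (sqrt r))\<^sup>2"
    using assms(2,3) by (simp add: power_mult_distrib of_real_power[symmetric] del: of_real_power)
  then obtain x where z: "z = \<i> * of_real x" and x: "\<bar>x\<bar> = sqrt r"
    using assms(3) unfolding power2_eq_iff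
    by (metis abs_minus_cancel abs_of_nonneg mult_minus_right of_real_minus real_sqrt_ge_zero)
  have "\<bar>x\<bar> \<le> m" using x assms(4) by (simp add: m_def)
  then have xm: "- m \<le> x" "x \<le> m" by auto
  show ?thesis
  proof (cases "m = 0")
    case True
    then have "z = 0" using xm z by simp
    then show ?thesis using zero_in_imaginary_segment by simp
  next
    case False
    then have m: "0 < m" using assms(3,4) by (simp add: m_def)
    define u where "u = (x + m) / (2 * m)"
    have u: "0 \<le> u" "u \<le> 1" using xm m by (auto simp: u_def field_simps)
    have x_eq: "x = (1 - u) * (- m) + u * m" using m by (simp add: u_def field_simps)
    have "z = \<i> * of_real ((1 - u) * (- m) + u * m)"
      unfolding x_eq[symmetric] by (rule z)
    then have "z = (1 - u) *\<^sub>R (- \<i> * of_real m) + u *\<^sub>R (\<i> * of_real m)"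
      by (simp add: scaleR_conv_of_real algebra_simps)
    then show ?thesis
      using u assms(1) unfolding imaginary_segment_def closed_segment_def m_def by auto
  qed
qed

context weighted_graph
begin

lemma inv_capacitance_nonneg: "e \<in> E \<Longrightarrow> 0 \<le> inv_capacitance C e"
  unfolding inv_capacitance_def using C_pos[of e]
  by (intro real_of_ereal_pos) (simp add: less_imp_le zero_le_divide_ereal)

lemma sup_ratio_finite:
  assumes "sup_ratio E L C \<noteq> \<infinity>"
  shows "0 \<le> real_of_ereal (sup_ratio E L C)"
    and "e \<in> E \<Longrightarrow> inv_capacitance C e \<le> real_of_ereal (sup_ratio E L C) * L e"
proof -
  define q where "q e = (if L e = 0 then \<infinity> else ereal (inv_capacitance C e / L e))" for e
  have S: "sup_ratio E L C = (SUP e\<in>E. q e)" by (simp add: sup_ratio_def q_def)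
  have q: "q e \<le> sup_ratio E L C" if "e \<in> E" for e
    unfolding S using that by (rule SUP_upper)
  have fin: "L e \<noteq> 0 \<and> 0 \<le> inv_capacitance C e / L e \<and>
      inv_capacitance C e / L e \<le> real_of_ereal (sup_ratio E L C)" if e: "e \<in> E" for e
  proof -
    have "L e \<noteq> 0" using q[OF e] assms by (auto simp: q_def)
    then show ?thesis
      using q[OF e] assms L_nonneg[OF e] inv_capacitance_nonneg[OF e]
      by (cases "sup_ratio E L C") (auto simp: q_def)
  qed
  show "0 \<le> real_of_ereal (sup_ratio E L C)"
  proof (cases "E = {}")
    \<comment> \<open>The supremum over no edges is \<open>- \<infinity>\<close>, which becomes the real number \<open>0\<close>.\<close>
    case True
    then show ?thesis by (simp add: sup_ratio_def bot_ereal_def)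
  next
    case False
    then obtain e where "e \<in> E" by blast
    then show ?thesis using fin[of e] by linarith
  qed
  show "inv_capacitance C e \<le> real_of_ereal (sup_ratio E L C) * L e" if e: "e \<in> E"
  proof -
    have "0 < L e" using fin[OF e] L_nonneg[OF e] by simp
    then show ?thesis using fin[OF e] by (simp add: divide_le_eq)
  qed
qed

text \<open>If \<open>S = \<infinity>\<close>, both \<open>t\<close> and \<open>1 / t\<close> lie in the half-plane given by the sign of \<open>Re t\<close>. If \<open>S\<close> is
  finite, the segment from \<open>t\<close> to \<open>t + S / t\<close> misses the origin, since \<open>t + u S / t = 0\<close> means
  \<open>t\<^sup>2 = - u S\<close>; a line separating it from the origin provides the half-plane.\<close>

lemma locally_uniformly_sectorial:
  assumes R0: "\<forall>e\<in>E. R e = 0" and t: "t \<notin> imaginary_segment (sup_ratio E L C)"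
  shows "\<exists>w \<kappa>. 0 < \<kappa> \<and> (\<forall>\<^sub>F s in nhds t. sectorial E R L C w \<kappa> s)"
proof -
  let ?S = "sup_ratio E L C" and ?D = "inv_capacitance C"
  have t0: "t \<noteq> 0" using t zero_in_imaginary_segment by blast
  have "\<exists>p q w. isCont p t \<and> isCont q t \<and> 0 < Re (w * p t) \<and> 0 < Re (w * q t) \<and>
      (\<forall>e\<in>E. \<exists>\<alpha> \<beta>. 0 \<le> \<alpha> \<and> 0 \<le> \<beta> \<and> 0 < \<alpha> + \<beta> \<and>
         (\<forall>s. impedance R L C s e = of_real \<alpha> * p s + of_real \<beta> * q s))"
  proof (cases "?S = \<infinity>")
    case True
    then have Re: "Re t \<noteq> 0" using t by (simp add: imaginary_segment_def)
    have "0 < Re (of_real (sgn (Re t)) * t)"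
      using Re by (simp add: sgn_if)
    moreover have "0 < Re (of_real (sgn (Re t)) * (1 / t))"
    proof -
      have "Re (1 / t) = Re t / (norm t)\<^sup>2" by (simp add: Re_divide cmod_power2)
      then show ?thesis using Re t0 by (auto simp: sgn_if divide_neg_pos)
    qed
    moreover have "isCont (\<lambda>s. 1 / s) t" using t0 by (intro continuous_intros)
    moreover have "\<exists>\<alpha> \<beta>. 0 \<le> \<alpha> \<and> 0 \<le> \<beta> \<and> 0 < \<alpha> + \<beta> \<and>
         (\<forall>s. impedance R L C s e = of_real \<alpha> * s + of_real \<beta> * (1 / s))" if e: "e \<in> E" for e
      using L_nonneg[OF e] inv_capacitance_nonneg[OF e] weight_pos[OF e] R0 e
      by (intro exI[of _ "L e"] exI[of _ "?D e"]) (simp add: impedance_def)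
    ultimately show ?thesis
      by (intro exI[of _ "\<lambda>s. s"] exI[of _ "\<lambda>s. 1 / s"] exI[of _ "of_real (sgn (Re t))"]) auto
  next
    case False
    define r where "r = real_of_ereal ?S"
    have r: "0 \<le> r" "\<And>e. e \<in> E \<Longrightarrow> ?D e \<le> r * L e"
      using sup_ratio_finite[OF False] by (simp_all add: r_def)
    have "0 \<notin> closed_segment t (t + of_real r / t)"
    proof
      assume "0 \<in> closed_segment t (t + of_real r / t)"
      then obtain u where u: "0 \<le> u" "u \<le> 1" "0 = (1 - u) *\<^sub>R t + u *\<^sub>R (t + of_real r / t)"
        by (auto simp: closed_segment_def)
      have "0 = t + of_real (u * r) / t"
        using u(3) by (simp add: scaleR_conv_of_real algebra_simps)
      then have "t\<^sup>2 = of_real (- (u * r))"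
        using t0 by (simp add: power2_eq_square field_simps add_eq_0_iff)
      moreover have "0 \<le> u * r" "u * r \<le> r" using u r by (auto simp: mult_left_le_one_le)
      ultimately show False
        using sqrt_negative_in_imaginary_segment[OF False, of t "u * r"] t by (simp add: r_def)
    qed
    then obtain b c where bc: "0 < c" "\<forall>x\<in>closed_segment t (t + of_real r / t). c < b \<bullet> x"
      using separating_hyperplane_closed_0[OF convex_closed_segment closed_segment] by metis
    have inner: "b \<bullet> x = Re (cnj b * x)" for x :: complex by (simp add: inner_complex_def)
    have "0 < Re (cnj b * t)" "0 < Re (cnj b * (t + of_real r / t))"
      using bc ends_in_segment unfolding inner[symmetric] by (meson less_trans)+
    moreover have "isCont (\<lambda>s. s + of_real r / s) t" using t0 by (intro continuous_intros)
    moreover have "\<exists>\<alpha> \<beta>. 0 \<le> \<alpha> \<and> 0 \<le> \<beta> \<and> 0 < \<alpha> + \<beta> \<and>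
         (\<forall>s. impedance R L C s e = of_real \<alpha> * s + of_real \<beta> * (s + of_real r / s))"
      if e: "e \<in> E" for e
    proof -
      have D: "0 \<le> ?D e" "?D e \<le> r * L e" using inv_capacitance_nonneg[OF e] r(2)[OF e] by auto
      have L: "0 < L e"
        using weight_pos[OF e] L_nonneg[OF e] D R0 e by (cases "L e = 0") auto
      have Dr: "?D e / r * r = ?D e" using D by (cases "r = 0") auto
      have "?D e / r \<le> L e" using D(2) r(1) L
        by (cases "r = 0") (auto simp: divide_le_eq mult.commute)
      moreover have "impedance R L C s e
          = of_real (L e - ?D e / r) * s + of_real (?D e / r) * (s + of_real r / s)" for s
      proof -
        have "impedance R L C s e = of_real (L e) * s + of_real (?D e / r * r) / s"
          using R0 e unfolding Dr by (simp add: impedance_def)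
        also have "\<dots> = of_real (L e - ?D e / r) * s + of_real (?D e / r) * (s + of_real r / s)"
          by (simp only: of_real_diff of_real_mult distrib_left left_diff_distrib
              times_divide_eq_right) simp
        finally show ?thesis .
      qed
      ultimately show ?thesis using D r(1) L
        by (intro exI[of _ "L e - ?D e / r"] exI[of _ "?D e / r"]) auto
    qed
    ultimately show ?thesis
      by (intro exI[of _ "\<lambda>s. s"] exI[of _ "\<lambda>s. s + of_real r / s"] exI[of _ "cnj b"]) auto
  qed
  then obtain p q w where cone: "isCont p t" "isCont q t" "0 < Re (w * p t)" "0 < Re (w * q t)"
    and z: "\<And>e. e \<in> E \<Longrightarrow> \<exists>\<alpha> \<beta>. 0 \<le> \<alpha> \<and> 0 \<le> \<beta> \<and> 0 < \<alpha> + \<beta> \<and>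
         (\<forall>s. impedance R L C s e = of_real \<alpha> * p s + of_real \<beta> * q s)"
    by blast
  obtain \<kappa> where \<kappa>: "0 < \<kappa>" and ev: "\<forall>\<^sub>F s in nhds t. \<forall>\<alpha> \<beta>. 0 \<le> \<alpha> \<longrightarrow> 0 \<le> \<beta> \<longrightarrow> 0 < \<alpha> + \<beta> \<longrightarrow>
      (let z = of_real \<alpha> * p s + of_real \<beta> * q s in z \<noteq> 0 \<and> \<kappa> * norm z \<le> Re (w * z))"
    using cone_uniformly_sectorial[OF cone] by blast
  have "\<forall>\<^sub>F s in nhds t. sectorial E R L C (cnj w) \<kappa> s"
    using ev
  proof eventually_elim
    case (elim s)
    show ?case unfolding sectorial_def
    proof
      fix e assume "e \<in> E"
      then obtain \<alpha> \<beta> where "0 \<le> \<alpha>" "0 \<le> \<beta>" "0 < \<alpha> + \<beta>"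
        "impedance R L C s e = of_real \<alpha> * p s + of_real \<beta> * q s"
        using z by blast
      then have "impedance R L C s e \<noteq> 0 \<and> \<kappa> * norm (impedance R L C s e) \<le> Re (w * impedance R L C s e)"
        using elim by (simp add: Let_def)
      then show "impedance R L C s e \<noteq> 0 \<and>
          \<kappa> * norm (1 / impedance R L C s e) \<le> Re (cnj w * (1 / impedance R L C s e))"
        using sectorial_inverse by blast
    qed
  qed
  with \<kappa> show ?thesis by blast
qed

text \<open>At a real frequency \<open>x\<close> all impedances are real with the sign of \<open>x\<close>, so the sector degenerates
  to a half-line.\<close>

lemma sectorial_real:
  assumes R0: "\<forall>e\<in>E. R e = 0" and x: "x \<noteq> 0"
  shows "sectorial E R L C (of_real (sgn x)) 1 (of_real x)"
    and "Im (admittance E R L C (of_real x) u v) = 0"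
proof -
  have z: "impedance R L C (of_real x) e = of_real (L e * x + inv_capacitance C e / x)"
    if "e \<in> E" for e
    using that R0 by (simp add: impedance_def)
  show "Im (admittance E R L C (of_real x) u v) = 0"
  proof (cases "{u, v} \<in> E")
    case True
    define y where "y = L {u, v} * x + inv_capacitance C {u, v} / x"
    have "admittance E R L C (of_real x) u v = of_real (1 / y)"
      using True z[OF True] by (simp add: admittance_def y_def)
    then show ?thesis by (simp only: Im_complex_of_real)
  qed (simp add: admittance_def)
  show "sectorial E R L C (of_real (sgn x)) 1 (of_real x)"
    unfolding sectorial_def
  proof
    fix e assume e: "e \<in> E"
    define y where "y = L e * x + inv_capacitance C e / x"
    have "x * y = L e * x\<^sup>2 + inv_capacitance C e"
      using x by (simp add: y_def power2_eq_square algebra_simps)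
    moreover have "0 < L e * x\<^sup>2 + inv_capacitance C e"
      using L_nonneg[OF e] inv_capacitance_nonneg[OF e] weight_pos[OF e] R0 e x
      by (cases "L e = 0") (auto simp: add_pos_nonneg)
    ultimately have "0 < x * y" by simp
    then have "y \<noteq> 0" "\<bar>1 / y\<bar> \<le> sgn x * (1 / y)" by (auto simp: zero_less_mult_iff sgn_if)
    moreover have "1 / impedance R L C (of_real x) e = of_real (1 / y)"
      using z[OF e] by (simp add: y_def)
    ultimately show "impedance R L C (of_real x) e \<noteq> 0 \<and>
        1 * norm (1 / impedance R L C (of_real x) e)
        \<le> Re (of_real (sgn x) * (1 / impedance R L C (of_real x) e))"
      using z[OF e] by (simp add: y_def del: of_real_add of_real_divide)
  qed
qed

end

section \<open>The truncated networks\<close>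

context infinite_network
begin

abbreviation "V\<^sub>n \<equiv> trunc_verts V E a"
abbreviation "E\<^sub>n \<equiv> trunc_edges V E a"
abbreviation "B\<^sub>n \<equiv> trunc_sink V E a B"
abbreviation "\<P>\<^sub>n n s \<equiv> the (trunc_admittance V E R L C a B n s)"

lemma trunc_edges_subset: "E\<^sub>n n \<subseteq> E" by (auto simp: trunc_edges_def)

lemma dist_edge_le:
  assumes "{x, y} \<in> E"
  shows "graph_dist E a y \<le> Suc (graph_dist E a x)"
proof -
  have "(a, y) \<in> adjacency E ^^ Suc (graph_dist E a x)"
    using dist_walk edge_verts[OF assms] assms by (auto simp: adjacency_def)
  then show ?thesis by (rule dist_le)
qed

lemma edge_in_trunc_edges:
  assumes "graph_dist E a x < n"
  shows "{x, y} \<in> E\<^sub>n n \<longleftrightarrow> {x, y} \<in> E"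
  using dist_edge_le[of x y] edge_verts[of x y] assms
  by (auto simp: trunc_edges_def trunc_verts_def)

text \<open>A vertex inside the sphere of radius \<open>n\<close> has all its neighbours in the ball of radius \<open>n\<close>, so
  larger truncations do not change the Laplacian there.\<close>

lemma trunc_laplacian_eq:
  assumes x: "graph_dist E a x < n" and nm: "n \<le> m"
  shows "laplacian (V\<^sub>n m) (E\<^sub>n m) R L C s f x = laplacian (V\<^sub>n n) (E\<^sub>n n) R L C s f x"
proof -
  have adm: "admittance (E\<^sub>n k) R L C s x y = admittance E R L C s x y" if "n \<le> k" for k y
    using edge_in_trunc_edges[of x k y] x that by (simp add: admittance_def)
  have no_edge: "admittance (E\<^sub>n m) R L C s x y = 0" if "y \<in> V\<^sub>n m - V\<^sub>n n" for y
    using that x dist_edge_le[of x y] adm[OF nm] by (auto simp: trunc_verts_def admittance_def)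
  have "laplacian (V\<^sub>n m) (E\<^sub>n m) R L C s f x
      = (\<Sum>y\<in>V\<^sub>n n. (f y - f x) * admittance (E\<^sub>n m) R L C s x y)"
    unfolding laplacian_def using nm finite_trunc_verts
    by (intro sum.mono_neutral_right) (use no_edge in \<open>auto simp: trunc_verts_def\<close>)
  then show ?thesis by (simp add: laplacian_def adm nm)
qed

text \<open>The potential \<open>v\<close> of the smaller network vanishes on its outer sphere, so its extension by zero
  vanishes on the sinks of the larger one. The extension has the same energy: at a vertex
  where it is nonzero, all incident edges already belong to the smaller network.\<close>

lemma trunc_admittance_antimono:
  assumes R0: "\<forall>e\<in>E. R e = 0" and x: "x \<noteq> 0" and n: "1 \<le> n" "n \<le> m"
  shows "sgn x * Re (\<P>\<^sub>n m (of_real x)) \<le> sgn x * Re (\<P>\<^sub>n n (of_real x))"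
    and "Im (\<P>\<^sub>n m (of_real x)) = 0"
proof -
  let ?s = "of_real x :: complex"
  interpret N: finite_network "V\<^sub>n n" "E\<^sub>n n" R L C a "B\<^sub>n n" using finite_network_trunc[OF n(1)] .
  interpret M: finite_network "V\<^sub>n m" "E\<^sub>n m" R L C a "B\<^sub>n m"
    using finite_network_trunc[of m] n by simp
  have "sectorial (E\<^sub>n n) R L C (of_real (sgn x)) 1 ?s"
    using sectorial_subset[OF sectorial_real(1)[OF R0 x] trunc_edges_subset] .
  then obtain v where v: "N.solves ?s v" using N.ex_solution by fastforce
  define f where "f y = (if y \<in> V\<^sub>n n then v y else 0)" for y
  have fB: "f y = 0" if y: "y \<in> B\<^sub>n m" for y
  proof (cases "y \<in> V\<^sub>n n")
    case True
    then have "y \<in> B\<^sub>n n" using y n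
      by (auto simp: trunc_sink_def trunc_boundary_def trunc_verts_def)
    then show ?thesis using v True by (simp add: f_def dirichlet_solution_def)
  qed (simp add: f_def)
  have fa: "f a = 1" using v N.a_in_V by (simp add: f_def dirichlet_solution_def)
  have lap: "M.\<Delta> ?s f y = N.\<Delta> ?s v y" if y: "graph_dist E a y < n" "y \<in> V" for y
    using trunc_laplacian_eq[OF y(1) n(2), of ?s f] y
    by (auto simp: laplacian_def f_def trunc_verts_def intro!: sum.cong)
  have "(\<Sum>y\<in>V\<^sub>n m. cnj (f y) * M.\<Delta> ?s f y) = (\<Sum>y\<in>V\<^sub>n m. if y = a then N.\<Delta> ?s v a else 0)"
  proof (intro sum.cong refl)
    fix y assume y: "y \<in> V\<^sub>n m"
    consider "y = a" | "y \<noteq> a" "f y = 0" | "y \<noteq> a" "f y \<noteq> 0" by blast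
    then show "cnj (f y) * M.\<Delta> ?s f y = (if y = a then N.\<Delta> ?s v a else 0)"
    proof cases
      case 1
      then show ?thesis using lap[of a] fa n(1) a_in_V dist_self by simp
    next
      case 3
      then have yV: "y \<in> V\<^sub>n n" "v y \<noteq> 0" by (auto simp: f_def split: if_splits)
      then have yB: "y \<notin> B\<^sub>n n" using v by (auto simp: dirichlet_solution_def)
      then have "N.\<Delta> ?s v y = 0" using v yV 3 by (auto simp: dirichlet_solution_def)
      moreover have "graph_dist E a y < n" "y \<in> V"
        using yV yB by (auto simp: trunc_verts_def trunc_sink_def trunc_boundary_def)
      ultimately show ?thesis using lap 3 by simp
    qed simp
  qed
  then have "M.energy ?s f (\<lambda>y. cnj (f y)) = - N.\<Delta> ?s v a"
    using M.finite_V M.a_in_V by (simp add: M.energy_green)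
  also have "\<dots> = \<P>\<^sub>n n ?s"
    using N.effective_admittance_eq[OF v] by (simp add: trunc_admittance_def)
  finally have en: "M.energy ?s f (\<lambda>y. cnj (f y)) = \<P>\<^sub>n n ?s" .
  have sec: "sectorial (E\<^sub>n m) R L C (of_real (sgn x)) 1 ?s"
    using sectorial_subset[OF sectorial_real(1)[OF R0 x] trunc_edges_subset] .
  have real: "Im (M.\<rho> ?s y z) = 0" for y z
    using sectorial_real(2)[OF R0 x, of y z] trunc_edges_subset[of m]
    by (cases "{y, z} \<in> E\<^sub>n m") (auto simp: admittance_def)
  note dp = M.dirichlet_principle[where w = "sgn x" and \<kappa> = 1 and s = ?s and f = f, OF sec zero_less_one real fa]
  show "sgn x * Re (\<P>\<^sub>n m ?s) \<le> sgn x * Re (\<P>\<^sub>n n ?s)"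
    using dp(2) fB en by (simp add: trunc_admittance_def)
  show "Im (\<P>\<^sub>n m ?s) = 0"
    using dp(1) fB by (simp add: trunc_admittance_def)
qed

lemma trunc_admittance_nonneg:
  assumes R0: "\<forall>e\<in>E. R e = 0" and x: "x \<noteq> 0" and n: "1 \<le> n"
  shows "0 \<le> sgn x * Re (\<P>\<^sub>n n (of_real x))"
proof -
  let ?s = "of_real x :: complex"
  interpret N: finite_network "V\<^sub>n n" "E\<^sub>n n" R L C a "B\<^sub>n n" using finite_network_trunc[OF n] .
  have sec: "sectorial (E\<^sub>n n) R L C (of_real (sgn x)) 1 ?s"
    using sectorial_subset[OF sectorial_real(1)[OF R0 x] trunc_edges_subset] .
  then obtain v where v: "N.solves ?s v" using N.ex_solution by fastforce
  have "0 \<le> 1 * (\<Sum>x\<in>V\<^sub>n n. \<Sum>y\<in>V\<^sub>n n. norm (N.\<rho> ?s x y) * (norm (v y - v x))\<^sup>2) / 2"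
    by (simp add: sum_nonneg)
  also have "\<dots> \<le> Re (of_real (sgn x) * \<P>\<^sub>n n ?s)"
    using N.energy_sectorial_lower_bound[OF sec, of v] N.solution_energy[OF v]
    by (simp add: trunc_admittance_def)
  finally show ?thesis by simp
qed

lemma trunc_admittance_convergent_real:
  assumes R0: "\<forall>e\<in>E. R e = 0" and x: "x \<noteq> 0"
  shows "convergent (\<lambda>n. \<P>\<^sub>n (Suc n) (of_real x))"
proof -
  let ?p = "\<lambda>n. sgn x * Re (\<P>\<^sub>n (Suc n) (of_real x))"
  have dec: "decseq ?p"
    using trunc_admittance_antimono(1)[OF R0 x] by (intro decseq_SucI) simp
  have "\<forall>n. 0 \<le> ?p n" using trunc_admittance_nonneg[OF R0 x] by simp
  then obtain l where "?p \<longlonglongrightarrow> l"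
    using decseq_convergent[OF dec] by blast
  then have "(\<lambda>n. of_real (sgn x * ?p n)) \<longlonglongrightarrow> (of_real (sgn x * l) :: complex)"
    by (intro tendsto_intros)
  moreover have "of_real (sgn x * ?p n) = \<P>\<^sub>n (Suc n) (of_real x)" for n
    using trunc_admittance_antimono(2)[OF R0 x, of "Suc n" "Suc n"] x
    by (auto simp: complex_eq_iff sgn_if)
  ultimately show ?thesis by (auto simp: convergent_def)
qed

lemma trunc_admittance_exists:
  assumes "sectorial E R L C w \<kappa> s" "0 < \<kappa>" "1 \<le> n"
  shows "trunc_admittance V E R L C a B n s \<noteq> None"
proof -
  interpret N: finite_network "V\<^sub>n n" "E\<^sub>n n" R L C a "B\<^sub>n n" using finite_network_trunc[OF assms(3)] .
  show ?thesis
    using N.ex_solution[OF sectorial_subset[OF assms(1) trunc_edges_subset] assms(2)]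
      N.effective_admittance_eq by (auto simp: trunc_admittance_def)
qed

lemma trunc_admittance_bound:
  assumes s: "sectorial E R L C w \<kappa> s" "0 < \<kappa>" and K: "norm w \<le> \<kappa> * K" "0 < K" and n: "1 \<le> n"
  shows "norm (\<P>\<^sub>n n s) \<le> 2 * K * (\<Sum>y\<in>{y. {a, y} \<in> E}. norm (admittance E R L C s a y))"
proof -
  interpret N: finite_network "V\<^sub>n n" "E\<^sub>n n" R L C a "B\<^sub>n n" using finite_network_trunc[OF n] .
  have "(\<Sum>y\<in>V\<^sub>n n. norm (N.\<rho> s a y)) \<le> (\<Sum>y\<in>V\<^sub>n n. norm (admittance E R L C s a y))"
    using trunc_edges_subset by (intro sum_mono) (auto simp: admittance_def)
  also have "\<dots> = (\<Sum>y\<in>V\<^sub>n n \<inter> {y. {a, y} \<in> E}. norm (admittance E R L C s a y))"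
    using finite_trunc_verts by (intro sum.mono_neutral_right) (auto simp: admittance_def)
  also have "\<dots> \<le> (\<Sum>y\<in>{y. {a, y} \<in> E}. norm (admittance E R L C s a y))"
    using locally_finite[OF a_in_V] by (intro sum_mono2) auto
  finally have "2 * K * (\<Sum>y\<in>V\<^sub>n n. norm (N.\<rho> s a y))
      \<le> 2 * K * (\<Sum>y\<in>{y. {a, y} \<in> E}. norm (admittance E R L C s a y))"
    using K by (intro mult_left_mono) auto
  then show ?thesis
    using N.effective_admittance_bound[OF sectorial_subset[OF s(1) trunc_edges_subset] s(2) K]
    by (simp add: trunc_admittance_def)
qed

text \<open>The sum in \<open>trunc_admittance_bound\<close> runs over the finitely many neighbours of \<open>a\<close> and is
  therefore continuous in \<open>s\<close>; it does not depend on \<open>n\<close>.\<close>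

lemma trunc_admittance_locally_bounded:
  assumes t: "t \<noteq> 0" and \<kappa>: "0 < \<kappa>" and sec: "\<forall>\<^sub>F s in nhds t. sectorial E R L C w \<kappa> s"
  shows "\<exists>M. \<forall>\<^sub>F s in nhds t. \<forall>n. norm (\<P>\<^sub>n (Suc n) s) \<le> M"
proof -
  \<comment> \<open>The summand \<open>1\<close> makes \<open>K\<close> positive even if \<open>w = 0\<close>.\<close>
  define K where "K = norm w / \<kappa> + 1"
  have K: "norm w \<le> \<kappa> * K" "0 < K" using \<kappa> by (auto simp: K_def field_simps add_pos_nonneg)
  let ?F = "\<lambda>s. 2 * K * (\<Sum>y\<in>{y. {a, y} \<in> E}. norm (admittance E R L C s a y))"
  have "sectorial E R L C w \<kappa> t" using sec by (rule eventually_nhds_x_imp_x)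
  then have "isCont (\<lambda>s. admittance E R L C s a y) t" for y
    using admittance_field_differentiable[of t a y E R L C] t
    by (intro field_differentiable_imp_continuous_at) (auto simp: sectorial_def)
  then have "isCont ?F t" by (intro continuous_intros)
  then have "(?F \<longlongrightarrow> ?F t) (nhds t)"
    unfolding isCont_def using tendsto_at_iff_tendsto_nhds[of ?F t] by blast
  then have "\<forall>\<^sub>F s in nhds t. ?F s < ?F t + 1" by (rule order_tendstoD) simp
  with sec have "\<forall>\<^sub>F s in nhds t. \<forall>n. norm (\<P>\<^sub>n (Suc n) s) \<le> ?F t + 1"
  proof eventually_elim
    case (elim s)
    show ?case
    proof
      fix n
      have "norm (\<P>\<^sub>n (Suc n) s) \<le> ?F s"
        by (rule trunc_admittance_bound[OF elim(1) \<kappa> K]) simp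
      with elim(2) show "norm (\<P>\<^sub>n (Suc n) s) \<le> ?F t + 1" by linarith
    qed
  qed
  then show ?thesis by blast
qed

lemma trunc_admittance_field_differentiable:
  assumes "t \<noteq> 0" "0 < \<kappa>" "\<forall>\<^sub>F s in nhds t. sectorial E R L C w \<kappa> s" and n: "1 \<le> n"
  shows "(\<lambda>s. \<P>\<^sub>n n s) field_differentiable at t"
proof -
  interpret N: finite_network "V\<^sub>n n" "E\<^sub>n n" R L C a "B\<^sub>n n" using finite_network_trunc[OF n] .
  have "\<forall>\<^sub>F s in nhds t. sectorial (E\<^sub>n n) R L C w \<kappa> s"
    using assms(3) by eventually_elim (rule sectorial_subset[OF _ trunc_edges_subset])
  then show ?thesis
    using N.effective_admittance_field_differentiable assms(1,2) by (simp add: trunc_admittance_def)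
qed

lemma admissible_trunc:
  assumes "s \<noteq> 0" "sectorial E R L C w \<kappa> s"
  shows "s \<in> admissible (E\<^sub>n n) R L C"
proof -
  have "of_real (L e) * s\<^sup>2 + of_real (R e) * s + of_real (inv_capacitance C e)
      = s * impedance R L C s e" for e
    using assms(1) by (simp add: impedance_def algebra_simps power2_eq_square)
  then show ?thesis
    using assms trunc_edges_subset by (auto simp: admissible_def sectorial_def)
qed

section \<open>The limit\<close>

text \<open>The reals of \<open>U\<close> near \<open>x\<close> serve as the set on which convergence is known beforehand. The
  index is shifted by one because the truncation at \<open>n = 0\<close> is not a network: its only vertex \<open>a\<close>
  is also a sink.\<close>

lemma trunc_admittance_limit_on_domain:
  assumes R0: "\<forall>e\<in>E. R e = 0"
    and U: "open U" "connected U" "U \<inter> imaginary_segment (sup_ratio E L C) = {}"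
    and x: "x \<noteq> 0" "of_real x \<in> U"
  obtains g where "g holomorphic_on U"
    "\<And>s. s \<in> U \<Longrightarrow> tendsto_finite (\<lambda>n. trunc_admittance V E R L C a B n s) (g s)"
proof -
  have sec: "\<exists>w \<kappa>. 0 < \<kappa> \<and> (\<forall>\<^sub>F s in nhds t. sectorial E R L C w \<kappa> s)" and t0: "t \<noteq> 0"
    if "t \<in> U" for t
    using locally_uniformly_sectorial[OF R0, of t] zero_in_imaginary_segment that U(3) by blast+
  define A where "A = {s \<in> U. s \<in> \<real> \<and> s \<noteq> 0}"
  have "of_real x islimpt A"
    unfolding islimpt_approachable
  proof (intro allI impI)
    fix e :: real assume e: "0 < e"
    obtain d where d: "0 < d" "ball (of_real x) d \<subseteq> U" using U(1) x(2) open_contains_ball by blast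
    \<comment> \<open>The bound by \<open>\<bar>x\<bar>\<close> keeps \<open>x + h\<close> away from zero when \<open>x\<close> is negative.\<close>
    define h where "h = min (min d e) \<bar>x\<bar> / 2"
    have h: "0 < h" "h < d" "h < e" "h < \<bar>x\<bar>" using d e x by (auto simp: h_def)
    have "dist (of_real (x + h)) (of_real x :: complex) = h"
      using h by (simp add: dist_norm)
    then have "of_real (x + h) \<in> U" "dist (of_real (x + h)) (of_real x :: complex) < e"
      using d h by (auto simp: dist_commute subset_iff)
    moreover have "x + h \<noteq> 0" "x + h \<noteq> x" using h by auto
    ultimately show "\<exists>s\<in>A. s \<noteq> of_real x \<and> dist s (of_real x) < e"
      unfolding A_def
      by (intro bexI[of _ "of_real (x + h)"]) (auto simp flip: of_real_add)
  qed
  moreover have "convergent (\<lambda>n. \<P>\<^sub>n (Suc n) s)" if "s \<in> A" for s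
    using that trunc_admittance_convergent_real[OF R0] by (auto simp: A_def elim!: Reals_cases)
  moreover have "(\<lambda>s. \<P>\<^sub>n (Suc n) s) holomorphic_on U" for n
    unfolding holomorphic_on_def
  proof
    fix t assume t: "t \<in> U"
    then show "(\<lambda>s. \<P>\<^sub>n (Suc n) s) field_differentiable at t within U"
      using sec[OF t] t0[OF t] trunc_admittance_field_differentiable[of t _ _ "Suc n"]
      by (auto intro: field_differentiable_at_within)
  qed
  moreover have "\<exists>M. \<forall>\<^sub>F s in nhds t. \<forall>n. norm (\<P>\<^sub>n (Suc n) s) \<le> M" if t: "t \<in> U" for t
    using sec[OF t] t0[OF t] trunc_admittance_locally_bounded by blast
  ultimately obtain g where g: "g holomorphic_on U" "\<And>s. s \<in> U \<Longrightarrow> (\<lambda>n. \<P>\<^sub>n (Suc n) s) \<longlonglongrightarrow> g s"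
    using vitali_porter[of U "\<lambda>n s. \<P>\<^sub>n (Suc n) s" A "of_real x"] U(1,2) x(2)
    unfolding A_def by blast
  have "tendsto_finite (\<lambda>n. trunc_admittance V E R L C a B n s) (g s)" if s: "s \<in> U" for s
  proof -
    obtain w \<kappa> where "0 < \<kappa>" "sectorial E R L C w \<kappa> s"
      using sec[OF s] eventually_nhds_x_imp_x by blast
    then have "\<forall>\<^sub>F n in sequentially. trunc_admittance V E R L C a B n s \<noteq> None"
      using trunc_admittance_exists by (intro eventually_sequentiallyI[of 1]) blast
    moreover have "(\<lambda>n. \<P>\<^sub>n n s) \<longlonglongrightarrow> g s"
      using g(2)[OF s] by (rule LIMSEQ_imp_Suc)
    ultimately show ?thesis by (simp add: tendsto_finite_iff)
  qed
  with g(1) that show thesis by blast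
qed

lemma limit_admittance_eq:
  "tendsto_finite (\<lambda>n. trunc_admittance V E R L C a B n s) l \<Longrightarrow> limit_admittance V E R L C a B s = l"
  unfolding limit_admittance_def by (rule the_equality) (auto intro: tendsto_finite_unique)

end

theorem corollary24:
  fixes V :: "'v set" and E :: "'v set set"
    and R L :: "'v set \<Rightarrow> real" and C :: "'v set \<Rightarrow> ereal"
    and a :: 'v and B :: "'v set"
  assumes "infinite_network V E R L C a B"
    and "\<forall>e\<in>E. R e = 0"
  shows "(\<forall>s \<in> UNIV - imaginary_segment (sup_ratio E L C).
            (\<forall>n\<ge>1. s \<in> admissible (trunc_edges V E a n) R L C) \<and>
            (\<exists>l. tendsto_finite (\<lambda>n. trunc_admittance V E R L C a B n s) l)) \<and>
         limit_admittance V E R L C a B holomorphic_on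
           (UNIV - imaginary_segment (sup_ratio E L C))"
proof -
  interpret infinite_network V E R L C a B by (rule assms(1))
  let ?\<Omega> = "UNIV - imaginary_segment (sup_ratio E L C)"
  have domain: "\<exists>U x. open U \<and> connected U \<and> s \<in> U \<and> U \<subseteq> ?\<Omega> \<and> x \<noteq> 0 \<and> of_real x \<in> U"
    if s: "s \<in> ?\<Omega>" for s
  proof (cases "sup_ratio E L C = \<infinity>")
    case True
    then have \<Omega>: "?\<Omega> = {z. Re z \<noteq> 0}" by (auto simp: imaginary_segment_def)
    then consider "0 < Re s" | "Re s < 0" using s by fastforce
    then show ?thesis
    proof cases
      case 1
      then show ?thesis unfolding \<Omega>
        by (intro exI[of _ "{z. 0 < Re z}"] exI[of _ 1])
          (auto simp: open_halfspace_Re_gt convex_halfspace_Re_gt convex_connected)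
    next
      case 2
      then show ?thesis unfolding \<Omega>
        by (intro exI[of _ "{z. Re z < 0}"] exI[of _ "-1"])
          (auto simp: open_halfspace_Re_lt convex_halfspace_Re_lt convex_connected)
    qed
  next
    case False
    then have "bounded (imaginary_segment (sup_ratio E L C))"
      "convex (imaginary_segment (sup_ratio E L C))"
      by (auto simp: imaginary_segment_def bounded_closed_segment)
    then have "connected (- imaginary_segment (sup_ratio E L C))"
      by (rule connected_complement_bounded_convex) simp
    then have "connected ?\<Omega>" by (simp add: Compl_eq_Diff_UNIV)
    moreover have "open ?\<Omega>" using closed_imaginary_segment by (simp add: open_Diff)
    moreover have "of_real 1 \<in> ?\<Omega>" using Re_imaginary_segment[of 1] by auto
    ultimately show ?thesis using s by (intro exI[of _ ?\<Omega>] exI[of _ 1]) auto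
  qed
  have main: "(\<exists>l. tendsto_finite (\<lambda>n. trunc_admittance V E R L C a B n s) l) \<and>
      limit_admittance V E R L C a B field_differentiable at s within ?\<Omega>" if s: "s \<in> ?\<Omega>" for s
  proof -
    obtain U x where U: "open U" "connected U" "s \<in> U" "U \<subseteq> ?\<Omega>" "x \<noteq> 0" "of_real x \<in> U"
      using domain[OF s] by blast
    then have "U \<inter> imaginary_segment (sup_ratio E L C) = {}" by blast
    then obtain g where g: "g holomorphic_on U"
      "\<And>s. s \<in> U \<Longrightarrow> tendsto_finite (\<lambda>n. trunc_admittance V E R L C a B n s) (g s)"
      using trunc_admittance_limit_on_domain[OF assms(2) U(1,2) _ U(5,6)] by metis
    then have "limit_admittance V E R L C a B holomorphic_on U"
      using limit_admittance_eq by (metis holomorphic_cong)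
    then have "limit_admittance V E R L C a B field_differentiable at s"
      using U(1,3) by (simp add: holomorphic_on_open field_differentiable_def)
    then show ?thesis using g(2)[OF U(3)] field_differentiable_at_within by blast
  qed
  have "s \<in> admissible (trunc_edges V E a n) R L C" if s: "s \<in> ?\<Omega>" for s n
  proof -
    have "s \<noteq> 0" using s zero_in_imaginary_segment by blast
    moreover obtain w \<kappa> where "sectorial E R L C w \<kappa> s"
      using locally_uniformly_sectorial[OF assms(2), of s] s eventually_nhds_x_imp_x by blast
    ultimately show ?thesis by (rule admissible_trunc)
  qed
  with main show ?thesis by (simp add: holomorphic_on_def)
qed

end
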